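(* Let $L$ be a finite join-distributive lattice with more than one element. Then \[ 2F_{Q_L}=\vartheta\bigl(F_{L\cup\{\hat 0\}}\bigr), \] where $L\cup\{\hat 0\}$ is the poset obtained from $L$ by adjoining a new minimum element $\hat 0$ (strictly below the minimum of $L$).
   Context: Write $[n]=\{1,\dots,n\}$. A convex closure on $[n]$ is a map $A\mapsto\langle A\rangle$ on subsets of $[n]$ with: $A\subseteq\langle A\rangle$; $A\subseteq B\Rightarrow\langle A\rangle\subseteq\langle B\rangle$; $\langle\langle A\rangle\rangle=\langle A\rangle$; and (anti-exchange) if $x\ne y$, $x,y\notin\langle A\rangle$ and $x\in\langle A\cup\{y\}\rangle$ then $y\notin\langle A\cup\{x\}\rangle$. Every $A\subseteq[n]$ has a unique minimal subset $\operatorname{ext}(A)\subseteq A$ with $\langle\operatorname{ext}(A)\rangle=\langle A\rangle$. A finite lattice is meet-distributive if for each $y\neq\hat 0$, if $x$ is the meet of all elements covered by $y$, then $[x,y]$ is a Boolean algebra. A lattice $L$ is join-distributive if its dual $L^*$ (all order relations reversed) is meet-distributive. The meet-distributive lattices are exactly the lattices of closed sets ($A=\langle A\rangle$), ordered by inclusion, of convex closures: identify $[n]$ with the set of join-irreducible elements of the meet-distributive lattice and put $\langle A\rangle=\{j : j\le\bigvee_{i\in A}i\}$; then $\langle\emptyset\rangle=\emptyset$. Accordingly, a join-distributive $L$ is identified with the closed sets of a convex closure on $[n]$ ordered by reverse inclusion, with minimum $[n]$ and maximum $\emptyset$. For join-distributive $L$ so represented, $Q_L$ is the poset whose elements are equivalence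 classes of pairs $(A,\varepsilon)$, $A\in L$ a closed set, $\varepsilon:[n]\to\{\pm1\}$, where $(A,\varepsilon)$ and $(A,\varepsilon')$ are identified when $\varepsilon|_{\operatorname{ext}(A)}=\varepsilon'|_{\operatorname{ext}(A)}$, together with an additional minimum element $\hat 0$. The order is $(B,\delta)\le(A,\varepsilon)$ iff $A\subseteq B$ and $\varepsilon,\delta$ agree on $\operatorname{ext}(A)\cap\operatorname{ext}(B)$. The maximum is the unique class with $A=\emptyset$. For a finite graded poset $P$ (with $\hat 0$, $\hat 1$) with rank function $\rho$, write $\rho(s,t)=\rho(t)-\rho(s)$ and \[F_P=\sum_{\substack{\hat 0=t_0<t_1<\cdots<t_k=\hat 1\\ 0<i_1<\cdots<i_k}} x_{i_1}^{\rho(t_0,t_1)}x_{i_2}^{\rho(t_1,t_2)}\cdots x_{i_k}^{\rho(t_{k-1},t_k)},\] and $\nu(P)=\sum_{t\in P}(-1)^{\rho(t)}\mu(\hat 0,t)$, where $\mu$ is the Möbius function of $P$. The $F_P$ span the algebra $\mathcal Q$ of quasisymmetric functions, and $\vartheta:\mathcal Q\to\mathcal Q$ is the (known to be well defined) linear map, in fact a Hopf algebra map, satisfying for every finite graded poset $P$ \[\vartheta(F_P)=\sum_{\substack{\hat 0=t_0<t_1<\cdots<t_k=\hat 1\\ 0<i_1<\cdots<i_k}}\nu([t_0,t_1])\cdots\nu([t_{k-1},t_k])\,x_{i_1}^{\rho(t_0,t_1)}\cdots x_{i_k}^{\rho(t_{k-1},t_k)}.\] *)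

theory Defs
  imports Complex_Main "HOL-Algebra.Lattice" "HOL-Library.Poly_Mapping"
begin

section \<open>Finite posets and lattices\<close>

text \<open>Posets are \<open>gorder\<close> structures satisfying the locale \<open>partial_order\<close> of HOL-Algebra (so
  \<open>eq\<close> is equality); the dual of \<open>L\<close> is \<open>inv_gorder L\<close>.\<close>

definition covered_by :: "('a, 'b) gorder_scheme \<Rightarrow> 'a \<Rightarrow> 'a \<Rightarrow> bool" where
  "covered_by P x y \<longleftrightarrow> x \<in> carrier P \<and> y \<in> carrier P \<and> x \<sqsubset>\<^bsub>P\<^esub> y \<and>
     \<not> (\<exists>z \<in> carrier P. x \<sqsubset>\<^bsub>P\<^esub> z \<and> z \<sqsubset>\<^bsub>P\<^esub> y)"

definition interval :: "('a, 'b) gorder_scheme \<Rightarrow> 'a \<Rightarrow> 'a \<Rightarrow> ('a, 'b) gorder_scheme" where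
  "interval P s t = P\<lparr>carrier := \<lbrace>s..t\<rbrace>\<^bsub>P\<^esub>\<rparr>"

definition boolean_algebra :: "('a, 'b) gorder_scheme \<Rightarrow> bool" where
  "boolean_algebra P \<longleftrightarrow> (\<exists>(k::nat) f. bij_betw f (carrier P) (Pow {1..k}) \<and>
     (\<forall>x \<in> carrier P. \<forall>y \<in> carrier P. x \<sqsubseteq>\<^bsub>P\<^esub> y \<longleftrightarrow> f x \<subseteq> f y))"

definition meet_distributive :: "('a, 'b) gorder_scheme \<Rightarrow> bool" where
  "meet_distributive L \<longleftrightarrow> lattice L \<and> finite (carrier L) \<and>
     (\<forall>y \<in> carrier L. y \<noteq> \<bottom>\<^bsub>L\<^esub> \<longrightarrow>
        boolean_algebra (interval L (\<Sqinter>\<^bsub>L\<^esub> {x. covered_by L x y}) y))"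

definition join_distributive :: "('a, 'b) gorder_scheme \<Rightarrow> bool" where
  "join_distributive L \<longleftrightarrow> meet_distributive (inv_gorder L)"

definition join_irreducibles :: "('a, 'b) gorder_scheme \<Rightarrow> 'a set" where
  "join_irreducibles L = {j \<in> carrier L. j \<noteq> \<bottom>\<^bsub>L\<^esub> \<and>
     (\<forall>a \<in> carrier L. \<forall>b \<in> carrier L. j = a \<squnion>\<^bsub>L\<^esub> b \<longrightarrow> j = a \<or> j = b)}"

definition adjoin_bottom :: "('a, 'b) gorder_scheme \<Rightarrow> 'a option gorder" where
  "adjoin_bottom P = \<lparr>carrier = insert None (Some ` carrier P), eq = (=),
     le = (\<lambda>x y. case x of None \<Rightarrow> True
                | Some a \<Rightarrow> (case y of None \<Rightarrow> False | Some b \<Rightarrow> a \<sqsubseteq>\<^bsub>P\<^esub> b))\<rparr>"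


section \<open>The convex closure of a meet-distributive lattice\<close>

text \<open>The labelling \<open>e\<close> (a bijection from \<open>{1..n}\<close> onto the join-irreducibles) carries out the
  identification of \<open>[n]\<close> with the set of join-irreducible elements.\<close>

definition lattice_closure :: "('a, 'b) gorder_scheme \<Rightarrow> nat \<Rightarrow> (nat \<Rightarrow> 'a) \<Rightarrow> nat set \<Rightarrow> nat set" where
  "lattice_closure M n e A = {j \<in> {1..n}. e j \<sqsubseteq>\<^bsub>M\<^esub> \<Squnion>\<^bsub>M\<^esub> (e ` A)}"

definition closed_sets :: "nat \<Rightarrow> (nat set \<Rightarrow> nat set) \<Rightarrow> nat set set" where
  "closed_sets n cl = {A. A \<subseteq> {1..n} \<and> cl A = A}"

definition ext :: "(nat set \<Rightarrow> nat set) \<Rightarrow> nat set \<Rightarrow> nat set" where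
  "ext cl A = (THE B. B \<subseteq> A \<and> cl B = cl A \<and> (\<forall>C. C \<subset> B \<longrightarrow> cl C \<noteq> cl A))"


section \<open>The poset of signed closed sets\<close>

definition signed_pairs :: "nat \<Rightarrow> (nat set \<Rightarrow> nat set) \<Rightarrow> (nat set \<times> (nat \<Rightarrow> int)) set" where
  "signed_pairs n cl = closed_sets n cl \<times> ({1..n} \<rightarrow>\<^sub>E {-1, 1})"

definition sign_equiv :: "nat \<Rightarrow> (nat set \<Rightarrow> nat set) \<Rightarrow>
    ((nat set \<times> (nat \<Rightarrow> int)) \<times> (nat set \<times> (nat \<Rightarrow> int))) set" where
  "sign_equiv n cl = {((A, \<epsilon>), (A', \<epsilon>')). (A, \<epsilon>) \<in> signed_pairs n cl \<and>
     (A', \<epsilon>') \<in> signed_pairs n cl \<and> A = A' \<and> (\<forall>i \<in> ext cl A. \<epsilon> i = \<epsilon>' i)}"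

text \<open>The order does not depend on the representatives, so quantifying over them existentially or
  universally makes no difference.\<close>

definition signed_poset :: "nat \<Rightarrow> (nat set \<Rightarrow> nat set) \<Rightarrow> (nat set \<times> (nat \<Rightarrow> int)) set gorder" where
  "signed_poset n cl = \<lparr>carrier = signed_pairs n cl // sign_equiv n cl, eq = (=),
     le = (\<lambda>X Y. \<exists>(B, \<delta>) \<in> X. \<exists>(A, \<epsilon>) \<in> Y.
            A \<subseteq> B \<and> (\<forall>i \<in> ext cl A \<inter> ext cl B. \<epsilon> i = \<delta> i))\<rparr>"

definition Q_poset :: "nat \<Rightarrow> (nat set \<Rightarrow> nat set) \<Rightarrow> (nat set \<times> (nat \<Rightarrow> int)) set option gorder" where
  "Q_poset n cl = adjoin_bottom (signed_poset n cl)"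


section \<open>Graded posets\<close>

definition rank_function :: "('a, 'b) gorder_scheme \<Rightarrow> ('a \<Rightarrow> nat) \<Rightarrow> bool" where
  "rank_function P \<rho> \<longleftrightarrow> \<rho> \<bottom>\<^bsub>P\<^esub> = 0 \<and> (\<forall>x y. covered_by P x y \<longrightarrow> \<rho> y = \<rho> x + 1)"

definition graded_poset :: "('a, 'b) gorder_scheme \<Rightarrow> bool" where
  "graded_poset P \<longleftrightarrow> partial_order P \<and> finite (carrier P) \<and>
     (\<exists>x. least P x (carrier P)) \<and> (\<exists>x. greatest P x (carrier P)) \<and> (\<exists>\<rho>. rank_function P \<rho>)"

text \<open>On the carrier of a graded poset the rank function is unique.\<close>

definition rank :: "('a, 'b) gorder_scheme \<Rightarrow> 'a \<Rightarrow> nat" where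
  "rank P = (SOME \<rho>. rank_function P \<rho>)"

text \<open>The guard only serves termination; the values are meaningful for finite posets.\<close>

function mobius :: "('a, 'b) gorder_scheme \<Rightarrow> 'a \<Rightarrow> 'a \<Rightarrow> int" where
  "mobius P s t =
     (if partial_order P \<and> finite (carrier P) \<and> s \<in> carrier P \<and> t \<in> carrier P \<and> s \<sqsubseteq>\<^bsub>P\<^esub> t
      then if s = t then 1
           else - (\<Sum>z \<in> {z \<in> carrier P. s \<sqsubseteq>\<^bsub>P\<^esub> z \<and> z \<sqsubset>\<^bsub>P\<^esub> t}. mobius P s z)
      else 0)"
  by pat_completeness auto

termination
proof (relation "measure (\<lambda>(P, s, t). card {z \<in> carrier P. z \<sqsubset>\<^bsub>P\<^esub> t})", goal_cases)
  case 1
  show ?case by simp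
next
  case (2 P s t z)
  then interpret partial_order P by simp
  from 2 have z: "z \<in> carrier P" "t \<in> carrier P" "z \<sqsubset>\<^bsub>P\<^esub> t" by auto
  have "y \<sqsubset>\<^bsub>P\<^esub> t" if "y \<in> carrier P" "y \<sqsubset>\<^bsub>P\<^esub> z" for y
    using that z by (meson lless_trans)
  with z have "{y \<in> carrier P. y \<sqsubset>\<^bsub>P\<^esub> z} \<subset> {y \<in> carrier P. y \<sqsubset>\<^bsub>P\<^esub> t}"
    by (auto simp: lless_eq)
  with 2 show ?case by (auto intro!: psubset_card_mono)
qed

declare mobius.simps [simp del]

definition nu :: "('a, 'b) gorder_scheme \<Rightarrow> int" where
  "nu P = (\<Sum>t \<in> carrier P. (-1) ^ rank P t * mobius P \<bottom>\<^bsub>P\<^esub> t)"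


section \<open>Quasisymmetric functions\<close>

text \<open>A formal power series with rational coefficients in \<open>x\<^sub>1, x\<^sub>2, \<dots>\<close> is the function
  sending a monomial, given by its exponents, to its coefficient. The index \<open>0\<close> stands for no
  variable, hence the first condition in \<open>quasisymmetric\<close>.\<close>

type_synonym series = "(nat \<Rightarrow>\<^sub>0 nat) \<Rightarrow> rat"

definition monomial :: "nat list \<Rightarrow> nat list \<Rightarrow> nat \<Rightarrow>\<^sub>0 nat" where
  "monomial is as = (\<Sum>(i, a) \<leftarrow> zip is as. Poly_Mapping.single i a)"

definition index_list :: "nat list \<Rightarrow> bool" where
  "index_list is \<longleftrightarrow> sorted_wrt (<) is \<and> (\<forall>i \<in> set is. 0 < i)"

definition quasisymmetric :: "series set" where
  "quasisymmetric = {f.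
     (\<forall>m. f m \<noteq> 0 \<longrightarrow> 0 \<notin> Poly_Mapping.keys m) \<and>
     (\<exists>d. \<forall>m. f m \<noteq> 0 \<longrightarrow> (\<Sum>i \<in> Poly_Mapping.keys m. Poly_Mapping.lookup m i) \<le> d) \<and>
     (\<forall>is js as. index_list is \<and> index_list js \<and> length is = length as \<and> length js = length as \<and>
        (\<forall>a \<in> set as. 0 < a) \<longrightarrow> f (monomial is as) = f (monomial js as))}"

definition bounded_chain :: "('a, 'b) gorder_scheme \<Rightarrow> 'a list \<Rightarrow> bool" where
  "bounded_chain P ts \<longleftrightarrow> ts \<noteq> [] \<and> set ts \<subseteq> carrier P \<and> sorted_wrt (\<lambda>s t. s \<sqsubset>\<^bsub>P\<^esub> t) ts \<and>
     hd ts = \<bottom>\<^bsub>P\<^esub> \<and> last ts = \<top>\<^bsub>P\<^esub>"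

definition rank_steps :: "('a, 'b) gorder_scheme \<Rightarrow> 'a list \<Rightarrow> nat list" where
  "rank_steps P ts = map2 (\<lambda>s t. rank P t - rank P s) (butlast ts) (tl ts)"

text \<open>The series \<open>\<Sum> w(t\<^sub>0, t\<^sub>1) \<cdots> w(t\<^sub>k\<^sub>-\<^sub>1, t\<^sub>k) x\<^bsub>i\<^sub>1\<^esub>\<^bsup>\<rho>(t\<^sub>0, t\<^sub>1)\<^esup> \<cdots>\<close>
  over all chains \<open>t\<^sub>0 < \<cdots> < t\<^sub>k\<close> from the minimum to the maximum and all
  \<open>0 < i\<^sub>1 < \<cdots> < i\<^sub>k\<close>, coefficient by coefficient. For graded \<open>P\<close> the rank steps are positive, so
  each monomial arises from only finitely many pairs.\<close>

definition chain_series :: "('a, 'b) gorder_scheme \<Rightarrow> ('a \<Rightarrow> 'a \<Rightarrow> rat) \<Rightarrow> series" where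
  "chain_series P w m =
     (\<Sum>(ts, is) \<in> {(ts, is). bounded_chain P ts \<and> index_list is \<and> length ts = length is + 1 \<and>
                      monomial is (rank_steps P ts) = m}.
        \<Prod>j < length is. w (ts ! j) (ts ! Suc j))"

definition F :: "('a, 'b) gorder_scheme \<Rightarrow> series" where
  "F P = chain_series P (\<lambda>_ _. 1)"

text \<open>The defining property of \<open>\<vartheta>\<close>. Posets on subsets of \<open>nat\<close> suffice, since every finite
  poset is isomorphic to one of these. As the \<open>F P\<close> span the quasisymmetric functions, the
  property determines \<open>\<vartheta>\<close> on them; its values on other series are irrelevant.\<close>

definition is_theta :: "(series \<Rightarrow> series) \<Rightarrow> bool" where
  "is_theta \<theta> \<longleftrightarrow>
     (\<forall>f \<in> quasisymmetric. \<theta> f \<in> quasisymmetric) \<and>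
     (\<forall>f \<in> quasisymmetric. \<forall>g \<in> quasisymmetric. \<theta> (\<lambda>m. f m + g m) = (\<lambda>m. \<theta> f m + \<theta> g m)) \<and>
     (\<forall>c. \<forall>f \<in> quasisymmetric. \<theta> (\<lambda>m. c * f m) = (\<lambda>m. c * \<theta> f m)) \<and>
     (\<forall>P :: nat gorder. graded_poset P \<longrightarrow>
        \<theta> (F P) = chain_series P (\<lambda>s t. of_int (nu (interval P s t))))"

end

theory Submission
  imports Defs
begin

text \<open>Forgetting signs maps \<open>Q\<^sub>L\<close> onto \<open>L\<close> with a minimum adjoined and preserves ranks. Choosing signs
  from the maximum \<open>\<emptyset>\<close> downwards, one finds that a chain \<open>0 < A\<^sub>1 < \<dots> < A\<^sub>k = \<emptyset>\<close> has
  \<open>\<Prod>\<^sub>i 2\<^bsup>|ext(A\<^sub>i) - A\<^sub>i\<^sub>+\<^sub>1|\<^esup>\<close> lifts to \<open>Q\<^sub>L\<close>. On the other side, \<open>\<mu>(A, C)\<close> vanishes unless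
  \<open>A - C \<subseteq> ext(A)\<close>, in which case it is \<open>(-1)\<^bsup>|A - C|\<^esup>\<close>; so \<open>\<nu>([A, B])\<close> counts the subsets of
  \<open>ext(A) - B\<close>, which gives the same factors, while the bottom interval contributes
  \<open>\<nu>([0, A\<^sub>1]) = 2\<close>.

  That the lattice is the lattice of closed sets of a convex closure comes down to the fact that in a
  meet-distributive lattice an element has exactly one more join-irreducible below it than any
  element it covers.\<close>

section \<open>Finite graded posets\<close>

text \<open>The direction in which signs are chosen matters. An index of \<open>ext(A)\<close> lying
  in a closed \<open>B \<subseteq> A\<close> is extreme in \<open>B\<close> as well; so below a
  signed \<open>B\<close> the signs of \<open>A\<close> are prescribed on the part of
  \<open>ext(A)\<close> inside \<open>B\<close> and free on \<open>ext(A) - B\<close>. The count is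
  thus the same for all signings of \<open>B\<close> and equals the factor of \<open>\<nu>\<close>
  step by step. Built upwards, a lift would gain \<open>2^|ext(B) - ext(A)|\<close> per step, and
  only the product over the whole chain would agree. The same fact about extreme points makes the
  order of \<open>Q_L\<close> transitive. The factor 2 of the theorem stems from the first step
  alone: the adjoined minimum has the single atom \<open>[n]\<close> above it, so the Mobius
  function of a bottom interval takes the values 1, -1, 0, 0, ..., whereas in \<open>Q_L\<close>
  only one element lies over the minimum. Anti-exchange enters as the removability of a point
  because this is what a lower cover in a meet-distributive lattice provides, and because generation
  by extreme points, the rank and the Mobius values can be read off from it.\<close>

lemma bottom_eqI:
  assumes "partial_order P" "x \<in> carrier P" "\<And>y. y \<in> carrier P \<Longrightarrow> x \<sqsubseteq>\<^bsub>P\<^esub> y"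
  shows "\<bottom>\<^bsub>P\<^esub> = x"
proof -
  interpret partial_order P by fact
  have *: "least P x (carrier P)" using assms by (auto simp: least_def)
  then have "least P \<bottom>\<^bsub>P\<^esub> (carrier P)" unfolding bottom_def by (rule someI)
  with * show ?thesis by (rule least_unique[rotated])
qed

lemma top_eqI:
  assumes "partial_order P" "x \<in> carrier P" "\<And>y. y \<in> carrier P \<Longrightarrow> y \<sqsubseteq>\<^bsub>P\<^esub> x"
  shows "\<top>\<^bsub>P\<^esub> = x"
proof -
  interpret partial_order P by fact
  have *: "greatest P x (carrier P)" using assms by (auto simp: greatest_def)
  then have "greatest P \<top>\<^bsub>P\<^esub> (carrier P)" unfolding top_def by (rule someI)
  with * show ?thesis by (rule greatest_unique[rotated])
qed

locale finite_poset = partial_order P for P (structure) +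
  assumes finite_carrier: "finite (carrier P)"
begin

lemma down_set_card_less:
  assumes "x \<sqsubset> y" "x \<in> carrier P" "y \<in> carrier P"
  shows "card {z \<in> carrier P. z \<sqsubset> x} < card {z \<in> carrier P. z \<sqsubset> y}"
proof (rule psubset_card_mono)
  show "finite {z \<in> carrier P. z \<sqsubset> y}" using finite_carrier by simp
  have "x \<in> {z \<in> carrier P. z \<sqsubset> y}" "x \<notin> {z \<in> carrier P. z \<sqsubset> x}"
    using assms by (auto simp: lless_eq)
  moreover have "{z \<in> carrier P. z \<sqsubset> x} \<subseteq> {z \<in> carrier P. z \<sqsubset> y}"
    using assms lless_trans by blast
  ultimately show "{z \<in> carrier P. z \<sqsubset> x} \<subset> {z \<in> carrier P. z \<sqsubset> y}" by blast
qed

lemma lless_induct [consumes 1, case_names less]: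
  assumes "x \<in> carrier P"
    and "\<And>x. x \<in> carrier P \<Longrightarrow> (\<And>y. y \<in> carrier P \<Longrightarrow> y \<sqsubset> x \<Longrightarrow> Q y) \<Longrightarrow> Q x"
  shows "Q x"
  using assms(1)
proof (induction "card {z \<in> carrier P. z \<sqsubset> x}" arbitrary: x rule: less_induct)
  case less
  then show ?case using assms(2) down_set_card_less by blast
qed

text \<open>Among the elements from \<open>x\<close> on that are strictly below \<open>y\<close>,
  one whose strict down-set has maximal size leaves no room between itself and
  \<open>y\<close>.\<close>

lemma obtain_lower_cover:
  assumes "x \<sqsubset> y" "x \<in> carrier P" "y \<in> carrier P"
  obtains z where "x \<sqsubseteq> z" "covered_by P z y"
proof -
  let ?S = "{z \<in> carrier P. x \<sqsubseteq> z \<and> z \<sqsubset> y}"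
  have "finite ?S" "x \<in> ?S" using finite_carrier assms by auto
  let ?f = "\<lambda>z. card {v \<in> carrier P. v \<sqsubset> z}"
  have "Max (?f ` ?S) \<in> ?f ` ?S" using \<open>finite ?S\<close> \<open>x \<in> ?S\<close> by (intro Max_in) auto
  then obtain z where z: "z \<in> ?S" "?f z = Max (?f ` ?S)" by auto
  then have max: "?f w \<le> ?f z" if "w \<in> ?S" for w using that \<open>finite ?S\<close> by auto
  have "\<not> (z \<sqsubset> w \<and> w \<sqsubset> y)" if "w \<in> carrier P" for w
  proof
    assume w: "z \<sqsubset> w \<and> w \<sqsubset> y"
    then have "w \<in> ?S" using z that le_trans[of x z w] assms by (auto simp: lless_eq)
    then show False using max[of w] down_set_card_less[of z w] w z that by auto
  qed
  with z assms show ?thesis by (intro that[of z]) (auto simp: covered_by_def)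
qed

end

locale graded = finite_poset +
  assumes bottom: "\<exists>x. least P x (carrier P)"
    and top: "\<exists>x. greatest P x (carrier P)"
    and rank_function_exists: "\<exists>\<rho>. rank_function P \<rho>"
begin

sublocale weak_partial_order_bottom P
  by unfold_locales (rule bottom)

sublocale weak_partial_order_top P
  by unfold_locales (rule top)

lemma rank_function_rank: "rank_function P (rank P)"
  unfolding rank_def using rank_function_exists by (rule someI_ex)

lemma rank_bottom [simp]: "rank P \<bottom> = 0"
  using rank_function_rank by (simp add: rank_function_def)

lemma rank_covered: "covered_by P x y \<Longrightarrow> rank P y = rank P x + 1"
  using rank_function_rank by (simp add: rank_function_def)

text \<open>Every element other than \<open>\<bottom>\<close> covers some element, so a rank
  function is forced from \<open>\<bottom>\<close> upwards. This makes the choice operator in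
  \<open>rank\<close> harmless.\<close>

lemma rank_eqI:
  assumes "rank_function P \<rho>" "x \<in> carrier P"
  shows "rank P x = \<rho> x"
  using assms(2)
proof (induction x rule: lless_induct)
  case (less x)
  show ?case
  proof (cases "x = \<bottom>")
    case True
    then show ?thesis using assms(1) by (simp add: rank_function_def)
  next
    case False
    then have "\<bottom> \<sqsubset> x" using less by (auto simp: lless_eq)
    then obtain z where z: "covered_by P z x" using obtain_lower_cover less by blast
    then have "rank P z = \<rho> z" using less by (auto simp: covered_by_def)
    then show ?thesis using rank_covered[OF z] assms(1) z by (simp add: rank_function_def)
  qed
qed

lemma rank_less:
  assumes "x \<sqsubset> y" "x \<in> carrier P" "y \<in> carrier P"
  shows "rank P x < rank P y"
  using assms(3,1)
proof (induction y rule: lless_induct)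
  case (less y)
  then obtain z where z: "x \<sqsubseteq> z" "covered_by P z y"
    using obtain_lower_cover assms(2) by blast
  have "rank P x \<le> rank P z"
    using z less assms(2) by (cases "x = z") (auto simp: covered_by_def lless_eq intro: less_imp_le)
  then show ?case using rank_covered[OF z(2)] by simp
qed

lemma rank_le:
  assumes "x \<sqsubseteq> y" "x \<in> carrier P" "y \<in> carrier P"
  shows "rank P x \<le> rank P y"
  using rank_less[of x y] assms by (cases "x = y") (auto simp: lless_eq)

end

lemma graded_poset_iff: "graded_poset P \<longleftrightarrow> graded P"
  by (auto simp: graded_poset_def graded_def graded_axioms_def finite_poset_def finite_poset_axioms_def)

text \<open>The concrete posets below are graded through this rule: once a candidate
  \<open>\<rho>\<close> steps by one along covers, the grading, the actual \<open>rank\<close> and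
  both extremal elements come together.\<close>

lemma gradedI:
  assumes "partial_order P" "finite (carrier P)" "b \<in> carrier P" "t \<in> carrier P"
    and "\<And>x. x \<in> carrier P \<Longrightarrow> b \<sqsubseteq>\<^bsub>P\<^esub> x" "\<And>x. x \<in> carrier P \<Longrightarrow> x \<sqsubseteq>\<^bsub>P\<^esub> t"
    and "\<rho> b = 0" "\<And>x y. covered_by P x y \<Longrightarrow> \<rho> y = \<rho> x + 1"
  shows "graded P" and "x \<in> carrier P \<Longrightarrow> rank P x = \<rho> x"
    and "\<bottom>\<^bsub>P\<^esub> = b" and "\<top>\<^bsub>P\<^esub> = t"
proof -
  show b: "\<bottom>\<^bsub>P\<^esub> = b" using assms by (intro bottom_eqI) auto
  show "\<top>\<^bsub>P\<^esub> = t" using assms by (intro top_eqI) auto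
  have r: "rank_function P \<rho>" using assms b by (auto simp: rank_function_def)
  interpret partial_order P by fact
  show g: "graded P"
    using assms r by unfold_locales (auto simp: least_def greatest_def)
  show "x \<in> carrier P \<Longrightarrow> rank P x = \<rho> x"
    using graded.rank_eqI[OF g r] .
qed

lemma interval_simps [simp]:
  "carrier (interval P s t) = {x \<in> carrier P. s \<sqsubseteq>\<^bsub>P\<^esub> x \<and> x \<sqsubseteq>\<^bsub>P\<^esub> t}"
  "x \<sqsubseteq>\<^bsub>interval P s t\<^esub> y \<longleftrightarrow> x \<sqsubseteq>\<^bsub>P\<^esub> y"
  "x \<sqsubset>\<^bsub>interval P s t\<^esub> y \<longleftrightarrow> x \<sqsubset>\<^bsub>P\<^esub> y"
  by (auto simp: interval_def at_least_at_most_def lless_def)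

lemma partial_order_interval: "partial_order P \<Longrightarrow> partial_order (interval P s t)"
proof -
  assume "partial_order P"
  then interpret P: partial_order P .
  interpret I: weak_partial_order "interval P s t"
    unfolding interval_def
    by (rule weak_partial_order_subset) (auto simp: P.weak_partial_order_axioms at_least_at_most_def)
  show ?thesis by unfold_locales (simp add: interval_def P.eq_is_equal)
qed

context graded
begin

lemma graded_interval:
  assumes "s \<in> carrier P" "t \<in> carrier P" "s \<sqsubseteq> t"
  shows "graded (interval P s t)"
    and "x \<in> carrier (interval P s t) \<Longrightarrow> rank (interval P s t) x = rank P x - rank P s"
    and "\<bottom>\<^bsub>interval P s t\<^esub> = s" and "\<top>\<^bsub>interval P s t\<^esub> = t"
proof -
  let ?I = "interval P s t"
  have fin: "finite (carrier ?I)" using finite_carrier by simp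
  have st: "s \<in> carrier ?I" "t \<in> carrier ?I" using assms by auto
  have cov: "rank P y - rank P s = rank P x - rank P s + 1" if "covered_by ?I x y" for x y
  proof -
    have xy: "x \<in> carrier ?I" "y \<in> carrier ?I" "x \<sqsubset> y" using that by (auto simp: covered_by_def)
    \<comment> \<open>Intervals are order-convex, so \<open>P\<close> has no additional elements
      between \<open>x\<close> and \<open>y\<close>.\<close>
    have "covered_by P x y"
      unfolding covered_by_def
    proof safe
      fix z assume z: "z \<in> carrier P" "x \<sqsubset> z" "z \<sqsubset> y"
      then have "z \<in> carrier ?I"
        using xy assms by (auto simp: lless_eq intro: le_trans)
      then show False using that z by (auto simp: covered_by_def)
    qed (use xy in auto)
    \<comment> \<open>Ensures that the truncated subtraction of \<open>rank P s\<close> loses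
      nothing.\<close>
    moreover have "rank P s \<le> rank P x" using xy assms by (auto intro: rank_le)
    ultimately show ?thesis using rank_covered by auto
  qed
  note * = gradedI[of ?I s t "\<lambda>x. rank P x - rank P s", OF partial_order_interval fin st _ _ _ cov]
  show "graded ?I" by (rule *(1)) (auto simp: partial_order_axioms)
  show "x \<in> carrier ?I \<Longrightarrow> rank ?I x = rank P x - rank P s"
    by (rule *(2)) (auto simp: partial_order_axioms)
  show "\<bottom>\<^bsub>?I\<^esub> = s" by (rule *(3)) (auto simp: partial_order_axioms)
  show "\<top>\<^bsub>?I\<^esub> = t" by (rule *(4)) (auto simp: partial_order_axioms)
qed

end

text \<open>The sums over closed intervals determine the Mobius function inductively, so a guessed
  formula \<open>g\<close> only has to be tested on these sums.\<close>

lemma (in finite_poset) mobius_eqI: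
  assumes "s \<in> carrier P"
    and "\<And>t. t \<in> carrier P \<Longrightarrow> s \<sqsubseteq> t \<Longrightarrow>
      (\<Sum>z \<in> {z \<in> carrier P. s \<sqsubseteq> z \<and> z \<sqsubseteq> t}. g z) = (if s = t then 1 else 0)"
    and "t \<in> carrier P" "s \<sqsubseteq> t"
  shows "mobius P s t = g t"
  using assms(3,4)
proof (induction t rule: lless_induct)
  case (less t)
  have split: "{z \<in> carrier P. s \<sqsubseteq> z \<and> z \<sqsubseteq> t} = insert t {z \<in> carrier P. s \<sqsubseteq> z \<and> z \<sqsubset> t}"
    using less by (auto simp: lless_eq)
  have "(if s = t then 1 else 0) = g t + (\<Sum>z \<in> {z \<in> carrier P. s \<sqsubseteq> z \<and> z \<sqsubset> t}. g z)"
    using assms(2)[of t] less finite_carrier unfolding split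
    by (subst (asm) sum.insert) (auto simp: lless_eq)
  \<comment> \<open>For \<open>t = s\<close> nothing of the interval lies strictly below
    \<open>t\<close>, and the equation above reduces to \<open>g s = 1\<close>.\<close>
  moreover have "(\<Sum>z \<in> {z \<in> carrier P. s \<sqsubseteq> z \<and> z \<sqsubset> t}. g z) = 0" if "s = t"
    using that le_antisym less assms(1) by (intro sum.neutral) (fastforce simp: lless_eq)
  moreover have "(\<Sum>z \<in> {z \<in> carrier P. s \<sqsubseteq> z \<and> z \<sqsubset> t}. mobius P s z) =
      (\<Sum>z \<in> {z \<in> carrier P. s \<sqsubseteq> z \<and> z \<sqsubset> t}. g z)"
    using less by (intro sum.cong) auto
  ultimately show ?case
    using less assms(1) finite_carrier partial_order_axioms by (subst mobius.simps) (auto split: if_splits)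
qed

section \<open>Isomorphism invariance\<close>

locale poset_iso =
  P: partial_order P + P': partial_order P' for P (structure) and P' (structure) +
  fixes h
  assumes bij: "bij_betw h (carrier P) (carrier P')"
    and le_iff: "\<lbrakk>x \<in> carrier P; y \<in> carrier P\<rbrakk> \<Longrightarrow> h x \<sqsubseteq>\<^bsub>P'\<^esub> h y \<longleftrightarrow> x \<sqsubseteq>\<^bsub>P\<^esub> y"
begin

lemma closed [simp]: "x \<in> carrier P \<Longrightarrow> h x \<in> carrier P'"
  using bij by (auto simp: bij_betw_def)

lemma eq_iff: "\<lbrakk>x \<in> carrier P; y \<in> carrier P\<rbrakk> \<Longrightarrow> h x = h y \<longleftrightarrow> x = y"
  using bij by (auto simp: bij_betw_def inj_on_def)

lemma lless_iff: "\<lbrakk>x \<in> carrier P; y \<in> carrier P\<rbrakk> \<Longrightarrow> h x \<sqsubset>\<^bsub>P'\<^esub> h y \<longleftrightarrow> x \<sqsubset>\<^bsub>P\<^esub> y"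
  by (simp add: P.lless_eq P'.lless_eq le_iff eq_iff)

lemma carrier_image: "carrier P' = h ` carrier P"
  using bij by (auto simp: bij_betw_def)

lemma covered_iff: "\<lbrakk>x \<in> carrier P; y \<in> carrier P\<rbrakk> \<Longrightarrow> covered_by P' (h x) (h y) \<longleftrightarrow> covered_by P x y"
  by (simp add: covered_by_def lless_iff carrier_image)

lemma covered_image:
  assumes "covered_by P' x' y'"
  obtains x y where "x' = h x" "y' = h y" "covered_by P x y"
  using assms covered_iff unfolding covered_by_def carrier_image by blast

lemma graded_image:
  assumes "graded P"
  shows "graded P'" and "\<bottom>\<^bsub>P'\<^esub> = h \<bottom>\<^bsub>P\<^esub>" and "\<top>\<^bsub>P'\<^esub> = h \<top>\<^bsub>P\<^esub>"
    and "x \<in> carrier P \<Longrightarrow> rank P' (h x) = rank P x"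
proof -
  interpret G: graded P by fact
  let ?\<rho> = "\<lambda>x'. rank P (inv_into (carrier P) h x')"
  have inv: "inv_into (carrier P) h (h x) = x" if "x \<in> carrier P" for x
    using bij that by (simp add: bij_betw_def)
  have fin: "finite (carrier P')" using G.finite_carrier by (simp add: carrier_image)
  have cov: "?\<rho> y' = ?\<rho> x' + 1" if "covered_by P' x' y'" for x' y'
    using covered_image[OF that] G.rank_covered by (metis inv covered_by_def)
  have b: "h \<bottom>\<^bsub>P\<^esub> \<in> carrier P'" "h \<top>\<^bsub>P\<^esub> \<in> carrier P'" by auto
  note * = gradedI[of P' "h \<bottom>\<^bsub>P\<^esub>" "h \<top>\<^bsub>P\<^esub>" ?\<rho>, OF P'.partial_order_axioms fin b _ _ _ cov]
  show "graded P'" by (rule *(1)) (auto simp: carrier_image le_iff inv)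
  show "\<bottom>\<^bsub>P'\<^esub> = h \<bottom>\<^bsub>P\<^esub>" by (rule *(3)) (auto simp: carrier_image le_iff inv)
  show "\<top>\<^bsub>P'\<^esub> = h \<top>\<^bsub>P\<^esub>" by (rule *(4)) (auto simp: carrier_image le_iff inv)
  assume x: "x \<in> carrier P"
  then show "rank P' (h x) = rank P x"
    by (subst *(2)) (auto simp: carrier_image le_iff inv)
qed

lemma mobius_image:
  assumes "finite (carrier P)" "s \<in> carrier P" "t \<in> carrier P"
  shows "mobius P' (h s) (h t) = mobius P s t"
proof -
  interpret F: finite_poset P using assms by unfold_locales
  show ?thesis
    using assms(3)
  proof (induction t rule: F.lless_induct)
    case (less t)
    let ?D = "{z \<in> carrier P. s \<sqsubseteq>\<^bsub>P\<^esub> z \<and> z \<sqsubset>\<^bsub>P\<^esub> t}"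
    have D: "{z \<in> carrier P'. h s \<sqsubseteq>\<^bsub>P'\<^esub> z \<and> z \<sqsubset>\<^bsub>P'\<^esub> h t} = h ` ?D"
      using less assms by (auto simp: carrier_image le_iff lless_iff)
    have "inj_on h ?D" using eq_iff by (auto simp: inj_on_def)
    then have "(\<Sum>z \<in> h ` ?D. mobius P' (h s) z) = (\<Sum>z \<in> ?D. mobius P s z)"
      using less by (simp add: sum.reindex)
    with less assms D show ?case
      by (subst (1 2) mobius.simps)
        (simp add: le_iff eq_iff P.partial_order_axioms P'.partial_order_axioms carrier_image)
  qed
qed

lemma nu_image:
  assumes "graded P"
  shows "nu P' = nu P"
proof -
  interpret G: graded P by fact
  have "inj_on h (carrier P)" using bij by (simp add: bij_betw_def)
  then show ?thesis
    unfolding nu_def carrier_image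
    by (simp add: sum.reindex graded_image[OF assms] mobius_image G.finite_carrier)
qed

lemma poset_iso_interval:
  assumes "s \<in> carrier P" "t \<in> carrier P"
  shows "poset_iso (interval P s t) (interval P' (h s) (h t)) h"
proof -
  interpret I: partial_order "interval P s t" by (rule partial_order_interval) unfold_locales
  interpret I': partial_order "interval P' (h s) (h t)" by (rule partial_order_interval) unfold_locales
  show ?thesis
  proof
    show "bij_betw h (carrier (interval P s t)) (carrier (interval P' (h s) (h t)))"
      using eq_iff assms by (auto simp: bij_betw_def inj_on_def le_iff carrier_image)
  qed (simp add: le_iff)
qed

end

text \<open>A map that preserves and reflects the order is injective by antisymmetry, and the order
  axioms pass to its image. So only the comparison \<open>le\<close> has to be checked for a
  concrete map.\<close>

lemma poset_isoI:
  assumes "partial_order P" "eq P' = (=)" "carrier P' = h ` carrier P"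
    and le: "\<And>x y. \<lbrakk>x \<in> carrier P; y \<in> carrier P\<rbrakk> \<Longrightarrow> h x \<sqsubseteq>\<^bsub>P'\<^esub> h y \<longleftrightarrow> x \<sqsubseteq>\<^bsub>P\<^esub> y"
  shows "poset_iso P P' h"
proof -
  interpret P: partial_order P by fact
  have inj: "inj_on h (carrier P)"
  proof (rule inj_onI)
    fix x y assume "x \<in> carrier P" "y \<in> carrier P" "h x = h y"
    then show "x = y" using le[of x y] le[of y x] le[of x x] P.le_antisym[of x y] by simp
  qed
  interpret P': partial_order P'
  proof
    fix X Y Z assume "X \<sqsubseteq>\<^bsub>P'\<^esub> Y" "Y \<sqsubseteq>\<^bsub>P'\<^esub> Z" "X \<in> carrier P'" "Y \<in> carrier P'" "Z \<in> carrier P'"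
    moreover from this obtain x y z where "X = h x" "Y = h y" "Z = h z"
      "x \<in> carrier P" "y \<in> carrier P" "z \<in> carrier P"
      unfolding assms(3) by blast
    ultimately show "X \<sqsubseteq>\<^bsub>P'\<^esub> Z" using le P.le_trans[of x y z] by simp
  next
    fix X Y assume "X \<sqsubseteq>\<^bsub>P'\<^esub> Y" "Y \<sqsubseteq>\<^bsub>P'\<^esub> X" "X \<in> carrier P'" "Y \<in> carrier P'"
    moreover from this obtain x y where "X = h x" "Y = h y" "x \<in> carrier P" "y \<in> carrier P"
      unfolding assms(3) by blast
    ultimately show "X .=\<^bsub>P'\<^esub> Y" using le P.le_antisym[of x y] assms(2) by simp
  next
    fix X assume "X \<in> carrier P'"
    then show "X \<sqsubseteq>\<^bsub>P'\<^esub> X" unfolding assms(3) using le by blast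
  qed (simp_all add: assms(2))
  show ?thesis
    using inj assms(3) le by unfold_locales (auto simp: bij_betw_def)
qed

lemma (in poset_iso) poset_iso_inv: "poset_iso P' P (inv_into (carrier P) h)"
proof (rule poset_isoI)
  have inv: "inv_into (carrier P) h (h x) = x" if "x \<in> carrier P" for x
    using bij that by (simp add: bij_betw_def)
  show "partial_order P'" "eq P = (=)" by (simp_all add: P'.partial_order_axioms P.eq_is_equal)
  show "carrier P = inv_into (carrier P) h ` carrier P'" by (force simp: carrier_image inv image_iff)
  show "inv_into (carrier P) h x \<sqsubseteq>\<^bsub>P\<^esub> inv_into (carrier P) h y \<longleftrightarrow> x \<sqsubseteq>\<^bsub>P'\<^esub> y"
    if "x \<in> carrier P'" "y \<in> carrier P'" for x y
    using that by (auto simp: carrier_image inv le_iff)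
qed

section \<open>Chain series along rank-preserving maps\<close>

definition chain_weight :: "('a \<Rightarrow> 'a \<Rightarrow> rat) \<Rightarrow> 'a list \<Rightarrow> rat" where
  "chain_weight w ts = (\<Prod>j < length ts - 1. w (ts ! j) (ts ! Suc j))"

lemma chain_weight_singleton [simp]: "chain_weight w [t] = 1"
  by (simp add: chain_weight_def)

lemma chain_weight_Cons:
  assumes "ts \<noteq> []"
  shows "chain_weight w (t # ts) = w t (hd ts) * chain_weight w ts"
proof -
  obtain k where "length ts = Suc k" using assms by (cases ts) auto
  then show ?thesis
    using assms by (simp add: chain_weight_def prod.lessThan_Suc_shift hd_conv_nth del: prod.lessThan_Suc)
qed

lemma chain_weight_cong:
  assumes "\<And>s t. s \<in> set ts \<Longrightarrow> t \<in> set ts \<Longrightarrow> R s t \<Longrightarrow> w s t = w' s t" "sorted_wrt R ts"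
  shows "chain_weight w ts = chain_weight w' ts"
  unfolding chain_weight_def
  by (intro prod.cong refl assms(1)) (auto intro: sorted_wrt_nth_less[OF assms(2)])

definition chain_terms :: "('a, 'b) gorder_scheme \<Rightarrow> (nat \<Rightarrow>\<^sub>0 nat) \<Rightarrow> ('a list \<times> nat list) set" where
  "chain_terms P m = {(ts, is). bounded_chain P ts \<and> index_list is \<and> length ts = length is + 1 \<and>
     monomial is (rank_steps P ts) = m}"

lemma chain_series_eq:
  "chain_series P w m = (\<Sum>(ts, is) \<in> chain_terms P m. chain_weight w ts)"
  unfolding chain_series_def chain_terms_def chain_weight_def
  by (intro sum.cong) auto

text \<open>Exponents are natural numbers, so a positive one cannot cancel. This bounds the index
  lists that can produce a given monomial.\<close>

lemma keys_monomial:
  assumes "length is = length as" "\<forall>a \<in> set as. 0 < a"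
  shows "set is \<subseteq> Poly_Mapping.keys (monomial is as)"
  using assms
proof (induction "is" as rule: list_induct2)
  case (Cons i "is" a as)
  have *: "monomial (i # is) (a # as) = Poly_Mapping.single i a + monomial is as"
    by (simp add: monomial_def)
  have "Poly_Mapping.lookup (monomial (i # is) (a # as)) j \<noteq> 0"
    if "j = i \<or> j \<in> set is" for j
    using that Cons unfolding * by (auto simp: lookup_add lookup_single in_keys_iff)
  then show ?case by (auto simp: in_keys_iff)
qed (simp add: monomial_def)

context graded
begin

lemma length_rank_steps: "length (rank_steps P ts) = length ts - 1"
  by (simp add: rank_steps_def)

lemma rank_steps_pos:
  assumes "bounded_chain P ts" "a \<in> set (rank_steps P ts)"
  shows "0 < a"
proof -
  obtain j where j: "Suc j < length ts" "a = rank P (ts ! Suc j) - rank P (ts ! j)"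
    using assms(2)
    by (fastforce simp: rank_steps_def in_set_conv_nth nth_butlast nth_tl less_diff_conv)
  have "ts ! j \<sqsubset> ts ! Suc j"
    using assms(1) j by (auto simp: bounded_chain_def intro: sorted_wrt_nth_less)
  then show ?thesis
    using assms(1) j rank_less[of "ts ! j" "ts ! Suc j"]
    by (auto simp: bounded_chain_def subset_iff)
qed

lemma bounded_chain_distinct: "bounded_chain P ts \<Longrightarrow> distinct ts"
  by (auto simp: bounded_chain_def distinct_conv_nth lless_eq
      dest: sorted_wrt_nth_less elim!: linorder_neqE_nat)

text \<open>Chains are repetition-free lists over a finite carrier, and all indices are variables of
  \<open>m\<close>. Finiteness is what permits regrouping the terms of a chain series.\<close>

lemma finite_chain_terms: "finite (chain_terms P m)"
proof -
  let ?n = "card (carrier P)"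
  have len: "length ts \<le> ?n" if "bounded_chain P ts" for ts
    using that bounded_chain_distinct[OF that] finite_carrier
    by (metis bounded_chain_def card_mono distinct_card)
  have "chain_terms P m \<subseteq> {ts. set ts \<subseteq> carrier P \<and> length ts \<le> ?n} \<times>
      {is. set is \<subseteq> Poly_Mapping.keys m \<and> length is \<le> ?n}"
  proof safe
    fix ts "is" assume *: "(ts, is) \<in> chain_terms P m"
    then show "length ts \<le> ?n" "length is \<le> ?n" using len by (force simp: chain_terms_def)+
    fix i assume i: "i \<in> set is"
    have "set is \<subseteq> Poly_Mapping.keys (monomial is (rank_steps P ts))"
      using * rank_steps_pos by (intro keys_monomial) (auto simp: chain_terms_def length_rank_steps)
    then show "i \<in> Poly_Mapping.keys m" using i * by (auto simp: chain_terms_def)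
  next
    fix ts "is" t assume "(ts, is) \<in> chain_terms P m" "t \<in> set ts"
    then show "t \<in> carrier P" by (auto simp: chain_terms_def bounded_chain_def)
  qed
  moreover have "finite {ts. set ts \<subseteq> carrier P \<and> length ts \<le> ?n}"
    using finite_carrier by (rule finite_lists_length_le)
  moreover have "finite {is. set is \<subseteq> Poly_Mapping.keys m \<and> length is \<le> ?n}"
    by (rule finite_lists_length_le) simp
  ultimately show ?thesis by (meson finite_SigmaI finite_subset)
qed

lemma rank_eq_0_iff: "x \<in> carrier P \<Longrightarrow> rank P x = 0 \<longleftrightarrow> x = \<bottom>"
  using rank_less[of \<bottom> x] by (cases "x = \<bottom>") (auto simp: lless_eq)

end

text \<open>If the weights of the elements of each fibre lying below a fixed element add up to the weight
  downstairs, the lifts of a chain can be built from its top element downwards, one factor of the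
  weight at a time.\<close>

lemma chain_series_fibration:
  fixes P :: "('a, 'c) gorder_scheme" and P' :: "('b, 'd) gorder_scheme" and \<pi> :: "'b \<Rightarrow> 'a"
  assumes "graded P" "graded P'"
    and closed: "\<And>t. t \<in> carrier P' \<Longrightarrow> \<pi> t \<in> carrier P"
    and mono: "\<And>t u. \<lbrakk>t \<in> carrier P'; u \<in> carrier P'; t \<sqsubset>\<^bsub>P'\<^esub> u\<rbrakk> \<Longrightarrow> \<pi> t \<sqsubset>\<^bsub>P\<^esub> \<pi> u"
    and rank: "\<And>t. t \<in> carrier P' \<Longrightarrow> rank P (\<pi> t) = rank P' t"
    and top: "\<pi> \<top>\<^bsub>P'\<^esub> = \<top>\<^bsub>P\<^esub>"
    and fibre: "\<And>s u. \<lbrakk>s \<in> carrier P; u \<in> carrier P'; s \<sqsubset>\<^bsub>P\<^esub> \<pi> u\<rbrakk> \<Longrightarrow>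
      (\<Sum>t \<in> {t \<in> carrier P'. t \<sqsubset>\<^bsub>P'\<^esub> u \<and> \<pi> t = s}. w' t u) = w s (\<pi> u)"
  shows "chain_series P' w' = chain_series P w"
proof
  fix m
  interpret P: graded P by fact
  interpret P': graded P' by fact
  \<comment> \<open>The minimum is the only element of rank 0, and ranks are preserved.\<close>
  have bot_iff: "\<pi> t = \<bottom>\<^bsub>P\<^esub> \<longleftrightarrow> t = \<bottom>\<^bsub>P'\<^esub>" if "t \<in> carrier P'" for t
    using P.rank_eq_0_iff[OF closed[OF that]] P'.rank_eq_0_iff[OF that] rank[OF that] by simp
  have top_iff: "\<pi> t = \<top>\<^bsub>P\<^esub> \<longleftrightarrow> t = \<top>\<^bsub>P'\<^esub>" if "t \<in> carrier P'" for t
    using mono[OF that, of "\<top>\<^bsub>P'\<^esub>"] that top by (auto simp: P.lless_eq P'.lless_eq)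
  \<comment> \<open>End points are not prescribed here; \<open>bot_iff\<close> and
    \<open>top_iff\<close> force them as soon as \<open>ss\<close> is a bounded chain.\<close>
  define lifts where "lifts ss =
    {ts. set ts \<subseteq> carrier P' \<and> sorted_wrt (\<sqsubset>\<^bsub>P'\<^esub>) ts \<and> map \<pi> ts = ss}" for ss
  have fin_lifts: "finite (lifts ss)" for ss
    using finite_lists_length_eq[OF P'.finite_carrier, of "length ss"]
    by (rule rev_finite_subset) (auto simp: lifts_def)
  have lifts_sum: "(\<Sum>ts \<in> lifts ss. chain_weight w' ts) = chain_weight w ss"
    if "ss \<noteq> []" "set ss \<subseteq> carrier P" "sorted_wrt (\<sqsubset>\<^bsub>P\<^esub>) ss" "last ss = \<top>\<^bsub>P\<^esub>" for ss
    using that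
  proof (induction ss rule: list_nonempty_induct)
    case (single s)
    then have "lifts [s] = {[\<top>\<^bsub>P'\<^esub>]}"
      using top_iff by (auto simp: lifts_def map_eq_Cons_conv)
    then show ?case by simp
  next
    case (cons s ss)
    define B where "B ts = {t \<in> carrier P'. t \<sqsubset>\<^bsub>P'\<^esub> hd ts \<and> \<pi> t = s}" for ts
    have ne: "ts \<noteq> []" "hd ts \<in> carrier P'" "\<pi> (hd ts) = hd ss" if "ts \<in> lifts ss" for ts
      using that cons(1) by (cases ts; auto simp: lifts_def)+
    \<comment> \<open>By transitivity a new smallest element needs comparison with the head only, so
      the part of the fibre over \<open>s\<close> below \<open>hd ts\<close> describes all
      extensions of \<open>ts\<close>.\<close>
    have *: "(t # ts \<in> lifts (s # ss)) \<longleftrightarrow> ts \<in> lifts ss \<and> t \<in> B ts" for t ts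
    proof -
      have "(\<forall>u \<in> set ts. t \<sqsubset>\<^bsub>P'\<^esub> u) \<longleftrightarrow> t \<sqsubset>\<^bsub>P'\<^esub> hd ts"
        if mem: "ts \<in> lifts ss" "t \<in> carrier P'"
      proof -
        obtain u us where ts: "ts = u # us" using ne(1)[OF mem(1)] by (cases ts) auto
        with mem show ?thesis
          using P'.lless_trans[of t u] by (auto simp: lifts_def)
      qed
      then show ?thesis by (auto simp: lifts_def B_def)
    qed
    have "lifts (s # ss) = (\<lambda>(ts, t). t # ts) ` (SIGMA ts : lifts ss. B ts)"
    proof safe
      fix ts assume ts: "ts \<in> lifts (s # ss)"
      then obtain t ts' where "ts = t # ts'" by (auto simp: lifts_def map_eq_Cons_conv)
      with * ts show "ts \<in> (\<lambda>(ts, t). t # ts) ` (SIGMA ts : lifts ss. B ts)"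
        by (auto intro!: image_eqI[of _ _ "(ts', t)"])
    qed (use * in auto)
    then have "(\<Sum>ts \<in> lifts (s # ss). chain_weight w' ts) =
        (\<Sum>(ts, t) \<in> (SIGMA ts : lifts ss. B ts). chain_weight w' (t # ts))"
      by (simp add: sum.reindex inj_on_def case_prod_unfold)
    also have "\<dots> = (\<Sum>ts \<in> lifts ss. \<Sum>t \<in> B ts. chain_weight w' (t # ts))"
      using fin_lifts P'.finite_carrier by (intro sum.Sigma[symmetric]) (auto simp: B_def)
    also have "\<dots> = (\<Sum>ts \<in> lifts ss. w s (hd ss) * chain_weight w' ts)"
    proof (rule sum.cong[OF refl])
      fix ts assume ts: "ts \<in> lifts ss"
      have "s \<sqsubset>\<^bsub>P\<^esub> hd ss" using cons by (cases ss) auto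
      then have "(\<Sum>t \<in> B ts. w' t (hd ts)) = w s (hd ss)"
        using fibre[of s "hd ts"] ne[OF ts] cons by (simp add: B_def)
      then show "(\<Sum>t \<in> B ts. chain_weight w' (t # ts)) = w s (hd ss) * chain_weight w' ts"
        using ne[OF ts] by (simp add: chain_weight_Cons sum_distrib_right[symmetric])
    qed
    also have "\<dots> = w s (hd ss) * (\<Sum>ts \<in> lifts ss. chain_weight w' ts)"
      by (simp add: sum_distrib_left)
    also have "\<dots> = chain_weight w (s # ss)"
      using cons by (simp add: chain_weight_Cons)
    finally show ?case .
  qed
  \<comment> \<open>A chain and its image therefore yield the same monomial for every index
    list.\<close>
  have rank_steps: "rank_steps P (map \<pi> ts) = rank_steps P' ts" if "set ts \<subseteq> carrier P'" for ts
  proof -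
    have "rank P (\<pi> (ts ! i)) = rank P' (ts ! i)" if "i < length ts" for i
      using rank \<open>set ts \<subseteq> carrier P'\<close> that nth_mem by blast
    then show ?thesis
      by (intro nth_equalityI) (auto simp: rank_steps_def nth_butlast nth_tl)
  qed
  have bounded_iff: "bounded_chain P (map \<pi> ts) \<and> ts \<in> lifts (map \<pi> ts) \<longleftrightarrow> bounded_chain P' ts" for ts
  proof -
    have "sorted_wrt (\<sqsubset>\<^bsub>P\<^esub>) (map \<pi> ts)" if "set ts \<subseteq> carrier P'" "sorted_wrt (\<sqsubset>\<^bsub>P'\<^esub>) ts"
      unfolding sorted_wrt_map
      by (rule sorted_wrt_mono_rel[OF _ that(2)]) (use that(1) in \<open>auto intro!: mono\<close>)
    then show ?thesis
      using bot_iff[of "hd ts"] top_iff[of "last ts"] closed hd_in_set[of ts] last_in_set[of ts]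
      unfolding bounded_chain_def lifts_def
      by (cases "ts = []") (auto simp: hd_map last_map subset_iff)
  qed
  define g where "g = (\<lambda>(ts, is :: nat list). (map \<pi> ts, is))"
  have terms_iff: "(ts, is) \<in> chain_terms P' m \<longleftrightarrow>
      (map \<pi> ts, is) \<in> chain_terms P m \<and> ts \<in> lifts (map \<pi> ts)" for ts "is"
  proof (cases "set ts \<subseteq> carrier P'")
    case True
    show ?thesis
      unfolding chain_terms_def mem_Collect_eq prod.case bounded_iff[of ts, symmetric]
        rank_steps[OF True] length_map by blast
  next
    case False
    then show ?thesis by (auto simp: chain_terms_def bounded_chain_def lifts_def)
  qed
  have "chain_series P' w' m = (\<Sum>(ts, is) \<in> chain_terms P' m. chain_weight w' ts)"
    by (rule chain_series_eq)
  \<comment> \<open>The terms upstairs are grouped by the projected chain, with the index list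
    kept.\<close>
  also have "\<dots> = (\<Sum>y \<in> chain_terms P m.
      \<Sum>(ts, is) \<in> {x \<in> chain_terms P' m. g x = y}. chain_weight w' ts)"
    by (rule sum.group[symmetric, OF P'.finite_chain_terms P.finite_chain_terms])
      (auto simp: g_def terms_iff)
  also have "\<dots> = (\<Sum>(ss, is) \<in> chain_terms P m. chain_weight w ss)"
  proof (rule sum.cong[OF refl], safe)
    fix ss "is" assume ss: "(ss, is) \<in> chain_terms P m"
    have "x \<in> chain_terms P' m \<and> g x = (ss, is) \<longleftrightarrow> x \<in> (\<lambda>ts. (ts, is)) ` lifts ss" for x
    proof (cases x)
      case (Pair ts js)
      have "map \<pi> ts = ss" if "ts \<in> lifts ss" using that by (simp add: lifts_def)
      then show ?thesis
        using ss unfolding Pair g_def prod.case prod.inject terms_iff[of ts js] by blast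
    qed
    then have "{x \<in> chain_terms P' m. g x = (ss, is)} = (\<lambda>ts. (ts, is)) ` lifts ss"
      by blast
    then have "(\<Sum>(ts, is) \<in> {x \<in> chain_terms P' m. g x = (ss, is)}. chain_weight w' ts) =
        (\<Sum>ts \<in> lifts ss. chain_weight w' ts)"
      by (simp add: sum.reindex inj_on_def)
    also have "\<dots> = chain_weight w ss"
      using ss by (intro lifts_sum) (auto simp: chain_terms_def bounded_chain_def)
    finally show "(\<Sum>(ts, is) \<in> {x \<in> chain_terms P' m. g x = (ss, is)}. chain_weight w' ts) =
        chain_weight w ss" .
  qed
  also have "\<dots> = chain_series P w m" by (rule chain_series_eq[symmetric])
  finally show "chain_series P' w' m = chain_series P w m" .
qed

text \<open>The case of one-point fibres, with \<open>P\<close> lying over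
  \<open>P'\<close>.\<close>

lemma (in poset_iso) chain_series_image:
  assumes "graded P"
    and "\<And>s t. \<lbrakk>s \<in> carrier P; t \<in> carrier P; s \<sqsubset>\<^bsub>P\<^esub> t\<rbrakk> \<Longrightarrow> w' (h s) (h t) = w s t"
  shows "chain_series P w = chain_series P' w'"
proof (rule chain_series_fibration)
  show "graded P'" "graded P" "h \<top>\<^bsub>P\<^esub> = \<top>\<^bsub>P'\<^esub>"
    using graded_image[OF assms(1)] assms(1) by auto
  fix s u assume *: "s \<in> carrier P'" "u \<in> carrier P" "s \<sqsubset>\<^bsub>P'\<^esub> h u"
  then obtain t where t: "t \<in> carrier P" "s = h t" by (auto simp: carrier_image)
  with * have "{v \<in> carrier P. v \<sqsubset>\<^bsub>P\<^esub> u \<and> h v = s} = {t}"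
    by (auto simp: lless_iff eq_iff)
  then show "(\<Sum>v \<in> {v \<in> carrier P. v \<sqsubset>\<^bsub>P\<^esub> u \<and> h v = s}. w v u) = w' s (h u)"
    using assms(2)[of t u] * t by (auto simp: lless_iff)
qed (use graded_image(4)[OF assms(1)] in \<open>auto simp: lless_iff\<close>)

corollary (in poset_iso) F_image: "graded P \<Longrightarrow> F P = F P'"
  unfolding F_def by (rule chain_series_image) auto

text \<open>\<open>is_theta\<close> speaks of posets on natural numbers only. A finite carrier is
  injected into \<open>nat\<close> and the order carried along; both series are isomorphism
  invariants.\<close>

lemma theta_F:
  fixes P :: "('a, 'b) gorder_scheme"
  assumes "is_theta \<theta>" "graded P"
  shows "\<theta> (F P) = chain_series P (\<lambda>s t. of_int (nu (interval P s t)))"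
proof -
  interpret P: graded P by fact
  obtain g :: "'a \<Rightarrow> nat" where g: "inj_on g (carrier P)"
    using finite_imp_inj_to_nat_seg P.finite_carrier by metis
  define P' :: "nat gorder" where "P' = \<lparr>carrier = g ` carrier P, eq = (=),
    le = (\<lambda>x y. inv_into (carrier P) g x \<sqsubseteq>\<^bsub>P\<^esub> inv_into (carrier P) g y)\<rparr>"
  have le: "g x \<sqsubseteq>\<^bsub>P'\<^esub> g y \<longleftrightarrow> x \<sqsubseteq>\<^bsub>P\<^esub> y" if "x \<in> carrier P" "y \<in> carrier P" for x y
    using that g by (simp add: P'_def)
  interpret iso: poset_iso P P' g
    using P.partial_order_axioms le by (intro poset_isoI) (simp_all add: P'_def)
  have gr: "graded P'" by (rule iso.graded_image) fact
  have "\<theta> (F P) = \<theta> (F P')" using iso.F_image assms by simp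
  also have "\<dots> = chain_series P' (\<lambda>s t. of_int (nu (interval P' s t)))"
    using assms(1) gr by (auto simp: is_theta_def graded_poset_iff)
  also have "\<dots> = chain_series P (\<lambda>s t. of_int (nu (interval P s t)))"
  proof (rule iso.chain_series_image[symmetric])
    fix s t assume *: "s \<in> carrier P" "t \<in> carrier P" "s \<sqsubset>\<^bsub>P\<^esub> t"
    then interpret I: poset_iso "interval P s t" "interval P' (g s) (g t)" g
      by (intro iso.poset_iso_interval)
    have "graded (interval P s t)"
      using * by (intro P.graded_interval) (auto simp: P.lless_eq)
    then show "rat_of_int (nu (interval P' (g s) (g t))) = of_int (nu (interval P s t))"
      by (simp add: I.nu_image)
  qed fact
  finally show ?thesis .
qed

section \<open>Adjoining a minimum\<close>

lemma adjoin_bottom_simps [simp]: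
  "carrier (adjoin_bottom P) = insert None (Some ` carrier P)"
  "None \<sqsubseteq>\<^bsub>adjoin_bottom P\<^esub> y"
  "\<not> Some a \<sqsubseteq>\<^bsub>adjoin_bottom P\<^esub> None"
  "Some a \<sqsubseteq>\<^bsub>adjoin_bottom P\<^esub> Some b \<longleftrightarrow> a \<sqsubseteq>\<^bsub>P\<^esub> b"
  by (auto simp: adjoin_bottom_def)

lemma partial_order_adjoin_bottom:
  assumes "partial_order P"
  shows "partial_order (adjoin_bottom P)"
proof -
  interpret partial_order P by fact
  have [simp]: "eq (adjoin_bottom P) = (=)" by (simp add: adjoin_bottom_def)
  show ?thesis by unfold_locales (auto intro: le_trans)
qed

lemma (in partial_order) lless_adjoin_bottom [simp]:
  "\<not> x \<sqsubset>\<^bsub>adjoin_bottom L\<^esub> None"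
  "None \<sqsubset>\<^bsub>adjoin_bottom L\<^esub> Some b"
  "Some a \<sqsubset>\<^bsub>adjoin_bottom L\<^esub> Some b \<longleftrightarrow> a \<sqsubset> b"
proof -
  interpret A: partial_order "adjoin_bottom L"
    by (rule partial_order_adjoin_bottom) unfold_locales
  show "\<not> x \<sqsubset>\<^bsub>adjoin_bottom L\<^esub> None" by (cases x) (auto simp: A.lless_eq)
  show "None \<sqsubset>\<^bsub>adjoin_bottom L\<^esub> Some b" by (auto simp: A.lless_eq)
  show "Some a \<sqsubset>\<^bsub>adjoin_bottom L\<^esub> Some b \<longleftrightarrow> a \<sqsubset> b" by (auto simp: A.lless_eq lless_eq)
qed

lemma (in poset_iso) poset_iso_adjoin_bottom:
  "poset_iso (adjoin_bottom P) (adjoin_bottom P') (map_option h)"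
proof -
  interpret A: partial_order "adjoin_bottom P" by (rule partial_order_adjoin_bottom) unfold_locales
  interpret A': partial_order "adjoin_bottom P'" by (rule partial_order_adjoin_bottom) unfold_locales
  show ?thesis
  proof
    show "bij_betw (map_option h) (carrier (adjoin_bottom P)) (carrier (adjoin_bottom P'))"
      by (auto simp: bij_betw_def inj_on_def eq_iff carrier_image image_image)
  qed (auto simp: le_iff)
qed

text \<open>\<open>P\<close> may have many minimal elements, as the signed poset does. They become
  the atoms, whence the shift of the rank by one.\<close>

lemma graded_adjoin_bottom:
  assumes "partial_order P" "finite (carrier P)" "t \<in> carrier P"
    and "\<And>x. x \<in> carrier P \<Longrightarrow> x \<sqsubseteq>\<^bsub>P\<^esub> t"
    and min: "\<And>x. \<lbrakk>x \<in> carrier P; \<And>y. y \<in> carrier P \<Longrightarrow> \<not> y \<sqsubset>\<^bsub>P\<^esub> x\<rbrakk> \<Longrightarrow> \<rho> x = 0"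
    and cov: "\<And>x y. covered_by P x y \<Longrightarrow> \<rho> y = \<rho> x + 1"
  shows "graded (adjoin_bottom P)"
    and "x \<in> carrier P \<Longrightarrow> rank (adjoin_bottom P) (Some x) = \<rho> x + 1"
    and "\<bottom>\<^bsub>adjoin_bottom P\<^esub> = None" and "\<top>\<^bsub>adjoin_bottom P\<^esub> = Some t"
proof -
  interpret partial_order P by fact
  let ?r = "case_option 0 (\<lambda>x. \<rho> x + 1)"
  have cov': "?r y = ?r x + 1" if xy: "covered_by (adjoin_bottom P) x y" for x y
  proof -
    obtain y' where y: "y = Some y'" "y' \<in> carrier P"
      using xy by (cases y) (auto simp: covered_by_def)
    show ?thesis
    proof (cases x)
      case None
      then show ?thesis using that min[of y'] y by (auto simp: covered_by_def)
    next
      case (Some x')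
      then have "covered_by P x' y'" using that y by (auto simp: covered_by_def)
      then show ?thesis using cov Some y by simp
    qed
  qed
  have fin: "finite (carrier (adjoin_bottom P))" "None \<in> carrier (adjoin_bottom P)"
    "Some t \<in> carrier (adjoin_bottom P)" using assms by auto
  note * = gradedI[of "adjoin_bottom P" None "Some t" ?r,
      OF partial_order_adjoin_bottom fin _ _ _ cov', OF assms(1)]
  show "graded (adjoin_bottom P)" by (rule *(1)) (use assms in auto)
  show "\<bottom>\<^bsub>adjoin_bottom P\<^esub> = None" by (rule *(3)) (use assms in auto)
  show "\<top>\<^bsub>adjoin_bottom P\<^esub> = Some t" by (rule *(4)) (use assms in auto)
  show "x \<in> carrier P \<Longrightarrow> rank (adjoin_bottom P) (Some x) = \<rho> x + 1"
    by (subst *(2)) (use assms in auto)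
qed

section \<open>Convex closures\<close>

text \<open>Reverse inclusion, so that this models \<open>L\<close> and not the dual lattice in
  which the closure is built.\<close>

definition closed_poset :: "nat \<Rightarrow> (nat set \<Rightarrow> nat set) \<Rightarrow> nat set gorder" where
  "closed_poset n cl = \<lparr>carrier = closed_sets n cl, eq = (=), le = (\<lambda>A B. B \<subseteq> A)\<rparr>"

lemma closed_poset_simps [simp]:
  "carrier (closed_poset n cl) = closed_sets n cl"
  "A \<sqsubseteq>\<^bsub>closed_poset n cl\<^esub> B \<longleftrightarrow> B \<subseteq> A"
  "A \<sqsubset>\<^bsub>closed_poset n cl\<^esub> B \<longleftrightarrow> B \<subset> A"
  by (auto simp: closed_poset_def lless_def)

lemma partial_order_closed_poset: "partial_order (closed_poset n cl)"
  by unfold_locales (auto simp: closed_poset_def)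

text \<open>Expansion of the product of the factors \<open>- 1 + 1\<close> over \<open>E\<close>;
  the empty product is the exceptional case.\<close>

lemma sum_alternating_Pow:
  assumes "finite E"
  shows "(\<Sum>T \<in> Pow E. (- 1 :: int) ^ card T) = (if E = {} then 1 else 0)"
proof -
  have "(\<Sum>T \<in> Pow E. (- 1 :: int) ^ card T) = (\<Prod>x \<in> E. - 1 + 1)"
    using assms by (subst prod_add) auto
  then show ?thesis using assms by (simp add: power_0_left)
qed

text \<open>In the presence of the other axioms, \<open>removable\<close> is equivalent to anti-exchange.\<close>

locale convex_closure =
  fixes n :: nat and cl :: "nat set \<Rightarrow> nat set"
  assumes cl_subset: "A \<subseteq> {1..n} \<Longrightarrow> cl A \<subseteq> {1..n}"
    and cl_extensive: "A \<subseteq> {1..n} \<Longrightarrow> A \<subseteq> cl A"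
    and cl_mono: "A \<subseteq> B \<Longrightarrow> B \<subseteq> {1..n} \<Longrightarrow> cl A \<subseteq> cl B"
    and cl_idem: "A \<subseteq> {1..n} \<Longrightarrow> cl (cl A) = cl A"
    and cl_empty: "cl {} = {}"
    and removable: "\<lbrakk>A \<in> closed_sets n cl; B \<in> closed_sets n cl; A \<subset> B\<rbrakk> \<Longrightarrow>
      \<exists>x \<in> B - A. B - {x} \<in> closed_sets n cl"
begin

abbreviation "closeds \<equiv> closed_sets n cl"

lemma closedD: "A \<in> closeds \<Longrightarrow> A \<subseteq> {1..n}" "A \<in> closeds \<Longrightarrow> cl A = A" "A \<in> closeds \<Longrightarrow> finite A"
  by (auto simp: closed_sets_def intro: finite_subset)

lemma finite_closed: "finite closeds"
  by (rule finite_subset[of _ "Pow {1..n}"]) (auto simp: closed_sets_def)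

lemma full_closed: "{1..n} \<in> closeds"
  using cl_subset[of "{1..n}"] cl_extensive[of "{1..n}"] by (auto simp: closed_sets_def)

lemma empty_closed: "{} \<in> closeds"
  by (simp add: closed_sets_def cl_empty)

lemma Int_closed:
  assumes "A \<in> closeds" "B \<in> closeds"
  shows "A \<inter> B \<in> closeds"
proof -
  have "A \<inter> B \<subseteq> {1..n}" using closedD(1)[OF assms(1)] by blast
  moreover have "cl (A \<inter> B) \<subseteq> A" "cl (A \<inter> B) \<subseteq> B"
    using cl_mono[of "A \<inter> B" A] cl_mono[of "A \<inter> B" B] assms closedD by auto
  ultimately show ?thesis using cl_extensive[of "A \<inter> B"] by (auto simp: closed_sets_def)
qed

section \<open>Extreme points as the removable points of a closed set\<close>

lemma ext_eq:
  assumes A: "A \<in> closeds"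
  shows "ext cl A = {x \<in> A. A - {x} \<in> closeds}" (is "_ = ?E")
proof -
  note An = closedD[OF A]
  \<comment> \<open>A removable point lies in every generating set: the closure of a set avoiding
    \<open>x\<close> stays inside the closed set \<open>A - {x}\<close>.\<close>
  have gen: "x \<in> B" if "B \<subseteq> A" "cl B = cl A" "x \<in> ?E" for x B
  proof (rule ccontr)
    assume "x \<notin> B"
    then have "cl B \<subseteq> cl (A - {x})" using that An by (intro cl_mono) auto
    then have "A \<subseteq> A - {x}" using that An closedD(2)[of "A - {x}"] by auto
    then show False using that by auto
  qed
  have En: "?E \<subseteq> {1..n}" using An by auto
  \<comment> \<open>Otherwise \<open>removable\<close> yields a point outside \<open>cl ?E\<close>
    whose deletion from \<open>A\<close> leaves a closed set. Such a point belongs to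
    \<open>?E\<close>, a contradiction.\<close>
  have clE: "cl ?E = A"
  proof (rule ccontr)
    assume ne: "cl ?E \<noteq> A"
    have "cl ?E \<subseteq> A" using cl_mono[of ?E A] An by auto
    moreover have "cl ?E \<in> closeds" using En cl_subset cl_idem by (auto simp: closed_sets_def)
    ultimately obtain x where "x \<in> A - cl ?E" "A - {x} \<in> closeds"
      using removable[of "cl ?E" A] A ne by blast
    then show False using cl_extensive[OF En] by auto
  qed
  show ?thesis
    unfolding ext_def
  proof (rule the_equality)
    show "?E \<subseteq> A \<and> cl ?E = cl A \<and> (\<forall>C. C \<subset> ?E \<longrightarrow> cl C \<noteq> cl A)"
      using clE An gen by blast
  next
    fix B assume B: "B \<subseteq> A \<and> cl B = cl A \<and> (\<forall>C. C \<subset> B \<longrightarrow> cl C \<noteq> cl A)"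
    then have "?E \<subseteq> B" using gen by blast
    moreover have "cl ?E = cl A" using clE An by simp
    ultimately show "B = ?E" using B by blast
  qed
qed

lemma ext_subset: "A \<in> closeds \<Longrightarrow> ext cl A \<subseteq> A"
  by (auto simp: ext_eq)

lemma finite_ext: "A \<in> closeds \<Longrightarrow> finite (ext cl A)"
  using ext_subset closedD(3) finite_subset by metis

text \<open>\<open>B - {x}\<close> is the intersection of \<open>B\<close> with the closed set
  \<open>A - {x}\<close>. Transitivity of the signed order and the count of lifts rest on
  this.\<close>

lemma ext_restrict:
  assumes "A \<in> closeds" "B \<in> closeds" "B \<subseteq> A" "x \<in> ext cl A" "x \<in> B"
  shows "x \<in> ext cl B"
proof -
  have "B \<inter> (A - {x}) \<in> closeds" using assms by (auto simp: ext_eq intro: Int_closed)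
  moreover have "B \<inter> (A - {x}) = B - {x}" using assms by auto
  ultimately show ?thesis using assms by (simp add: ext_eq)
qed

lemma Diff_closed:
  assumes "A \<in> closeds" "T \<subseteq> ext cl A"
  shows "A - T \<in> closeds"
proof -
  have "finite T" using assms finite_ext finite_subset by metis
  then show ?thesis
    using assms(2)
  proof (induction T)
    case (insert x T)
    then have "(A - T) \<inter> (A - {x}) \<in> closeds"
      using assms(1) by (intro Int_closed) (auto simp: ext_eq)
    moreover have "(A - T) \<inter> (A - {x}) = A - insert x T" by auto
    ultimately show ?case by simp
  qed (use assms in auto)
qed

text \<open>This makes \<open>n - card A\<close> a rank function up to the shift by the adjoined
  minimum.\<close>

lemma between_closed:
  assumes "A \<in> closeds" "B \<in> closeds" "B \<subset> A" and no: "\<not> (\<exists>C \<in> closeds. B \<subset> C \<and> C \<subset> A)"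
  obtains x where "x \<in> ext cl A" "B = A - {x}"
proof -
  obtain x where x: "x \<in> A - B" "A - {x} \<in> closeds" using removable[of B A] assms by blast
  then have "A - {x} \<subset> A" "B \<subseteq> A - {x}" using assms(3) by auto
  then have "B = A - {x}" using no x(2) by (metis psubsetI)
  moreover have "x \<in> ext cl A" using x assms(1) by (simp add: ext_eq)
  ultimately show ?thesis using that by blast
qed

text \<open>The contributing \<open>C\<close> are the sets \<open>A - T\<close> with
  \<open>T\<close> an arbitrary set of extreme points outside \<open>B\<close>, all of them closed.
  An alternating \<open>f\<close> gives the Mobius sums, and \<open>f = 1\<close> gives
  \<open>nu\<close>.\<close>

lemma sum_below:
  fixes f :: "nat set \<Rightarrow> int"
  assumes "A \<in> closeds" "B \<in> closeds" "B \<subseteq> A"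
  shows "(\<Sum>C \<in> {C \<in> closeds. B \<subseteq> C \<and> C \<subseteq> A}. if A - C \<subseteq> ext cl A then f (A - C) else 0) =
    (\<Sum>T \<in> Pow (ext cl A - B). f T)"
proof -
  let ?S = "{C \<in> closeds. B \<subseteq> C \<and> C \<subseteq> A}"
  have "(\<Sum>C \<in> ?S. if A - C \<subseteq> ext cl A then f (A - C) else 0) =
      (\<Sum>C \<in> {C \<in> ?S. A - C \<subseteq> ext cl A}. f (A - C))"
    using finite_closed by (intro sum.inter_filter[symmetric]) auto
  also have "\<dots> = (\<Sum>T \<in> Pow (ext cl A - B). f T)"
  proof (rule sum.reindex_bij_witness[where i = "\<lambda>T. A - T" and j = "\<lambda>C. A - C"])
    fix T assume "T \<in> Pow (ext cl A - B)"
    then show "A - (A - T) = T" "A - T \<in> {C \<in> ?S. A - C \<subseteq> ext cl A}"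
      using assms ext_subset[OF assms(1)] Diff_closed[OF assms(1), of T] by auto
  qed (use assms in auto)
  finally show ?thesis .
qed

section \<open>Ranks, Mobius function and \<open>nu\<close> for closed sets with a minimum
  adjoined\<close>

abbreviation "M \<equiv> adjoin_bottom (closed_poset n cl)"

lemma graded_M:
  shows "graded M" and "A \<in> closeds \<Longrightarrow> rank M (Some A) = n - card A + 1"
    and "\<bottom>\<^bsub>M\<^esub> = None" and "\<top>\<^bsub>M\<^esub> = Some {}"
proof -
  have cov: "n - card B = n - card A + 1" if "covered_by (closed_poset n cl) A B" for A B
  proof -
    have *: "A \<in> closeds" "B \<in> closeds" "B \<subset> A" "\<not> (\<exists>C \<in> closeds. B \<subset> C \<and> C \<subset> A)"
      using that by (auto simp: covered_by_def)
    then obtain x where "x \<in> ext cl A" "B = A - {x}" using between_closed by blast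
    moreover have "card A \<le> n" using closedD[OF *(1)] card_mono[of "{1..n}" A] by simp
    ultimately show ?thesis
      using closedD[OF *(1)] ext_subset[OF *(1)] card_gt_0_iff[of A]
      by (auto simp: card_Diff_singleton)
  qed
  have min: "n - card A = 0" if "A \<in> carrier (closed_poset n cl)"
    "\<And>B. B \<in> carrier (closed_poset n cl) \<Longrightarrow> \<not> B \<sqsubset>\<^bsub>closed_poset n cl\<^esub> A" for A
    using that full_closed closedD(1)[of A] by fastforce
  note * = graded_adjoin_bottom[OF partial_order_closed_poset, of n cl "{}" "\<lambda>A. n - card A", OF _ _ _ min cov]
  show "graded M" by (rule *(1)) (auto simp: finite_closed empty_closed)
  show "\<bottom>\<^bsub>M\<^esub> = None" by (rule *(3)) (auto simp: finite_closed empty_closed)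
  show "\<top>\<^bsub>M\<^esub> = Some {}" by (rule *(4)) (auto simp: finite_closed empty_closed)
  assume "A \<in> closeds"
  then show "rank M (Some A) = n - card A + 1"
    by (subst *(2)) (auto simp: finite_closed empty_closed)
qed

interpretation M: graded M by (rule graded_M)

lemma nu_interval_closed:
  assumes A: "A \<in> closeds" and B: "B \<in> closeds" and BA: "B \<subseteq> A"
  shows "nu (interval M (Some A) (Some B)) = 2 ^ card (ext cl A - B)"
proof -
  let ?I = "interval M (Some A) (Some B)"
  \<comment> \<open>The closed sets from \<open>A - ext cl A\<close> to \<open>A\<close> form a
    Boolean lattice, hence the signs. The branch \<open>None\<close> lies outside the interval and
    is only a default.\<close>
  let ?g = "\<lambda>z. case z of None \<Rightarrow> 0
    | Some C \<Rightarrow> if A - C \<subseteq> ext cl A then (- 1 :: int) ^ card (A - C) else 0"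
  have AB: "Some A \<in> carrier M" "Some B \<in> carrier M" "Some A \<sqsubseteq>\<^bsub>M\<^esub> Some B" using assms by auto
  note I = M.graded_interval[OF AB]
  interpret I: graded ?I by (rule I)
  have mob: "mobius ?I (Some A) (Some D) = ?g (Some D)" if "D \<in> closeds" "B \<subseteq> D" "D \<subseteq> A" for D
  proof (rule I.mobius_eqI)
    fix t assume "t \<in> carrier ?I" "Some A \<sqsubseteq>\<^bsub>?I\<^esub> t"
    then obtain D where D: "t = Some D" "D \<in> closeds" "B \<subseteq> D" "D \<subseteq> A" by auto
    have "{z \<in> carrier ?I. Some A \<sqsubseteq>\<^bsub>?I\<^esub> z \<and> z \<sqsubseteq>\<^bsub>?I\<^esub> t} = Some ` {C \<in> closeds. D \<subseteq> C \<and> C \<subseteq> A}"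
      using D by auto
    then have "(\<Sum>z \<in> {z \<in> carrier ?I. Some A \<sqsubseteq>\<^bsub>?I\<^esub> z \<and> z \<sqsubseteq>\<^bsub>?I\<^esub> t}. ?g z) =
        (\<Sum>C \<in> {C \<in> closeds. D \<subseteq> C \<and> C \<subseteq> A}. ?g (Some C))"
      by (simp add: sum.reindex)
    also have "\<dots> = (\<Sum>T \<in> Pow (ext cl A - D). (- 1) ^ card T)"
      using sum_below[OF A D(2,4)] by simp
    also have "\<dots> = (if ext cl A - D = {} then 1 else 0)"
      using finite_ext[OF A] by (intro sum_alternating_Pow) simp
    \<comment> \<open>By \<open>removable\<close>, a closed set properly inside \<open>A\<close>
      misses an extreme point of \<open>A\<close>.\<close>
    also have "ext cl A - D = {} \<longleftrightarrow> A = D"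
      using D A ext_subset[OF A] removable[of D A] by (auto simp: ext_eq)
    finally show "(\<Sum>z \<in> {z \<in> carrier ?I. Some A \<sqsubseteq>\<^bsub>?I\<^esub> z \<and> z \<sqsubseteq>\<^bsub>?I\<^esub> t}. ?g z) =
      (if Some A = t then 1 else 0)" using D by simp
  qed (use that assms in auto)
  have rk: "rank ?I (Some D) = card (A - D)" if "D \<in> closeds" "B \<subseteq> D" "D \<subseteq> A" for D
  proof -
    have "card D \<le> card A" "card A \<le> n"
      using that closedD[OF A] card_mono[of "{1..n}" A] card_mono[of A D] by auto
    then show ?thesis
      using that A I(2)[of "Some D"] closedD(3)[of D] by (auto simp: graded_M card_Diff_subset)
  qed
  have "carrier ?I = Some ` {C \<in> closeds. B \<subseteq> C \<and> C \<subseteq> A}" by auto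
  then have "nu ?I = (\<Sum>C \<in> {C \<in> closeds. B \<subseteq> C \<and> C \<subseteq> A}.
      (- 1) ^ rank ?I (Some C) * mobius ?I (Some A) (Some C))"
    using I(3) by (simp add: nu_def sum.reindex)
  \<comment> \<open>The rank in the interval is \<open>card (A - C)\<close>, so the sign in
    \<open>nu\<close> cancels the sign of the Mobius function.\<close>
  also have "\<dots> = (\<Sum>C \<in> {C \<in> closeds. B \<subseteq> C \<and> C \<subseteq> A}. if A - C \<subseteq> ext cl A then 1 else 0)"
    by (rule sum.cong) (auto simp: rk mob power_add[symmetric])
  also have "\<dots> = (\<Sum>T \<in> Pow (ext cl A - B). 1)"
    using sum_below[OF A B BA, of "\<lambda>_. 1"] by simp
  also have "\<dots> = 2 ^ card (ext cl A - B)"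
    using finite_ext[OF A] by (simp add: card_Pow)
  finally show ?thesis .
qed

text \<open>The interval has the single atom \<open>Some {1..n}\<close>, of rank 1. The Mobius
  function is 1 at \<open>None\<close>, -1 at the atom and 0 elsewhere, so \<open>nu\<close> is 1 +
  1.\<close>

lemma nu_interval_bottom:
  assumes "B \<in> closeds"
  shows "nu (interval M None (Some B)) = 2"
proof -
  let ?I = "interval M None (Some B)"
  let ?g = "\<lambda>z. case z of None \<Rightarrow> 1 | Some C \<Rightarrow> if C = {1..n} then - 1 else (0 :: int)"
  have AB: "None \<in> carrier M" "Some B \<in> carrier M" "None \<sqsubseteq>\<^bsub>M\<^esub> Some B" using assms by auto
  note I = M.graded_interval[OF AB]
  interpret I: graded ?I by (rule I)
  \<comment> \<open>Serves both the test sums for the Mobius function and \<open>nu\<close>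
    itself.\<close>
  have interval_sum: "(\<Sum>z \<in> insert None (Some ` {C \<in> closeds. D \<subseteq> C}). f z) = f None + f (Some {1..n})"
    if "D \<in> closeds" "\<And>C. C \<in> closeds \<Longrightarrow> D \<subseteq> C \<Longrightarrow> C \<noteq> {1..n} \<Longrightarrow> f (Some C) = 0"
    for D and f :: "nat set option \<Rightarrow> int"
  proof -
    have "(\<Sum>C \<in> {C \<in> closeds. D \<subseteq> C}. f (Some C)) = (\<Sum>C \<in> {{1..n}}. f (Some C))"
      using that finite_closed full_closed closedD by (intro sum.mono_neutral_right) auto
    then show ?thesis using finite_closed by (subst sum.insert) (auto simp: sum.reindex)
  qed
  have mob: "mobius ?I None t = ?g t" if "t \<in> carrier ?I" for t
  proof (rule I.mobius_eqI)
    fix t assume t: "t \<in> carrier ?I"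
    show "(\<Sum>z \<in> {z \<in> carrier ?I. None \<sqsubseteq>\<^bsub>?I\<^esub> z \<and> z \<sqsubseteq>\<^bsub>?I\<^esub> t}. ?g z) = (if None = t then 1 else 0)"
    proof (cases t)
      case None
      have "{z \<in> carrier ?I. None \<sqsubseteq>\<^bsub>?I\<^esub> z \<and> z \<sqsubseteq>\<^bsub>?I\<^esub> None} = {None}" by auto
      with None show ?thesis by simp
    next
      case (Some D)
      with t have D: "D \<in> closeds" "B \<subseteq> D" by auto
      then have "{z \<in> carrier ?I. None \<sqsubseteq>\<^bsub>?I\<^esub> z \<and> z \<sqsubseteq>\<^bsub>?I\<^esub> Some D} = insert None (Some ` {C \<in> closeds. D \<subseteq> C})"
        by auto
      with Some show ?thesis using interval_sum[OF D(1), of ?g] by simp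
    qed
  qed (use that in auto)
  have carr: "carrier ?I = insert None (Some ` {C \<in> closeds. B \<subseteq> C})" by auto
  have "nu ?I = (\<Sum>z \<in> carrier ?I. (- 1) ^ rank ?I z * ?g z)"
    unfolding nu_def I(3) by (intro sum.cong refl) (simp add: mob)
  also have "\<dots> = (- 1) ^ rank ?I None * ?g None + (- 1) ^ rank ?I (Some {1..n}) * ?g (Some {1..n})"
    unfolding carr by (rule interval_sum) (use assms in auto)
  also have "\<dots> = 2"
    using I(2)[of None] I(2)[of "Some {1..n}"] full_closed closedD[OF assms] M.rank_bottom
    by (auto simp: graded_M)
  finally show ?thesis .
qed

end

section \<open>Signed closed sets\<close>

text \<open>A class of pairs \<open>(A, \<epsilon>)\<close> is represented by the restriction of \<open>\<epsilon>\<close> to \<open>ext cl A\<close>.\<close>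

definition signed_model :: "nat \<Rightarrow> (nat set \<Rightarrow> nat set) \<Rightarrow> (nat set \<times> (nat \<Rightarrow> int)) gorder" where
  "signed_model n cl = \<lparr>carrier = (SIGMA A : closed_sets n cl. ext cl A \<rightarrow>\<^sub>E {-1, 1}), eq = (=),
     le = (\<lambda>(B, \<delta>) (A, \<epsilon>). A \<subseteq> B \<and> (\<forall>i \<in> ext cl A \<inter> ext cl B. \<epsilon> i = \<delta> i))\<rparr>"

lemma signed_model_simps [simp]:
  "carrier (signed_model n cl) = (SIGMA A : closed_sets n cl. ext cl A \<rightarrow>\<^sub>E {-1, 1})"
  "(B, \<delta>) \<sqsubseteq>\<^bsub>signed_model n cl\<^esub> (A, \<epsilon>) \<longleftrightarrow> A \<subseteq> B \<and> (\<forall>i \<in> ext cl A \<inter> ext cl B. \<epsilon> i = \<delta> i)"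
  by (auto simp: signed_model_def)

context convex_closure
begin

interpretation M: graded M by (rule graded_M)

abbreviation "Q0 \<equiv> signed_model n cl"

lemma partial_order_Q0: "partial_order Q0"
proof -
  have [simp]: "eq Q0 = (=)" by (simp add: signed_model_def)
  show ?thesis
  proof
    fix x y z assume "x \<sqsubseteq>\<^bsub>Q0\<^esub> y" "y \<sqsubseteq>\<^bsub>Q0\<^esub> z" "x \<in> carrier Q0" "y \<in> carrier Q0" "z \<in> carrier Q0"
    moreover obtain A \<epsilon> B \<delta> C \<gamma> where xyz: "x = (C, \<gamma>)" "y = (B, \<delta>)" "z = (A, \<epsilon>)"
      by (metis prod.exhaust)
    ultimately have *: "A \<in> closeds" "B \<in> closeds" "C \<in> closeds" "A \<subseteq> B" "B \<subseteq> C"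
      "\<forall>i \<in> ext cl B \<inter> ext cl C. \<delta> i = \<gamma> i" "\<forall>i \<in> ext cl A \<inter> ext cl B. \<epsilon> i = \<delta> i" by auto
    \<comment> \<open>An index extreme in both outer sets lies in \<open>A \<subseteq> B\<close>,
      hence is extreme in \<open>B\<close>, whose sign then mediates between the other two.\<close>
    have "i \<in> ext cl B" if "i \<in> ext cl A" "i \<in> ext cl C" for i
      using ext_restrict[OF *(3,2,5) that(2)] ext_subset[OF *(1)] that *(4) by blast
    then show "x \<sqsubseteq>\<^bsub>Q0\<^esub> z" using * unfolding xyz by auto
  next
    fix x y assume "x \<sqsubseteq>\<^bsub>Q0\<^esub> y" "y \<sqsubseteq>\<^bsub>Q0\<^esub> x" "x \<in> carrier Q0" "y \<in> carrier Q0"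
    moreover obtain A \<epsilon> B \<delta> where xy: "x = (B, \<delta>)" "y = (A, \<epsilon>)"
      by (metis prod.exhaust)
    ultimately have "A = B" "\<epsilon> \<in> ext cl A \<rightarrow>\<^sub>E {-1, 1}" "\<delta> \<in> ext cl A \<rightarrow>\<^sub>E {-1, 1}"
      "\<forall>i \<in> ext cl A. \<epsilon> i = \<delta> i" by auto
    then have "A = B" "\<epsilon> = \<delta>" using PiE_ext[of \<epsilon> "ext cl A" "\<lambda>_. {-1, 1}" \<delta>] by auto
    then show "x .=\<^bsub>Q0\<^esub> y" by (simp add: xy)
  next
    fix x assume "x \<in> carrier Q0"
    then show "x \<sqsubseteq>\<^bsub>Q0\<^esub> x" by (cases x) simp
  qed simp_all
qed

interpretation Q0: partial_order Q0 by (rule partial_order_Q0)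

lemma lless_Q0:
  assumes "(B, \<delta>) \<in> carrier Q0" "(A, \<epsilon>) \<in> carrier Q0"
  shows "(B, \<delta>) \<sqsubset>\<^bsub>Q0\<^esub> (A, \<epsilon>) \<longleftrightarrow> A \<subset> B \<and> (\<forall>i \<in> ext cl A \<inter> ext cl B. \<epsilon> i = \<delta> i)"
proof -
  have "\<epsilon> = \<delta>" if "A = B" "\<forall>i \<in> ext cl A. \<epsilon> i = \<delta> i"
    using that assms by (intro PiE_ext[of \<epsilon> "ext cl A" "\<lambda>_. {-1, 1}"]) auto
  then show ?thesis by (auto simp: Q0.lless_eq)
qed

lemma ext_empty: "ext cl {} = {}"
  using ext_subset[OF empty_closed] by auto

lemma graded_Q0:
  shows "graded (adjoin_bottom Q0)"
    and "(A, \<epsilon>) \<in> carrier Q0 \<Longrightarrow> rank (adjoin_bottom Q0) (Some (A, \<epsilon>)) = n - card A + 1"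
    and "\<bottom>\<^bsub>adjoin_bottom Q0\<^esub> = None" and "\<top>\<^bsub>adjoin_bottom Q0\<^esub> = Some ({}, \<lambda>_. undefined)"
proof -
  let ?r = "\<lambda>(A, \<epsilon>). n - card A"
  have min: "?r x = 0" if x: "x \<in> carrier Q0" and "\<And>y. y \<in> carrier Q0 \<Longrightarrow> \<not> y \<sqsubset>\<^bsub>Q0\<^esub> x" for x
  proof -
    obtain A \<epsilon> where A: "x = (A, \<epsilon>)" "A \<in> closeds" "\<epsilon> \<in> ext cl A \<rightarrow>\<^sub>E {-1, 1}" using x by auto
    \<comment> \<open>A signing of the full set below \<open>(A, \<epsilon>)\<close>: it copies
      \<open>\<epsilon>\<close> on the indices extreme in both sets; 1 is an arbitrary
      filler.\<close>
    let ?\<delta> = "restrict (\<lambda>i. if i \<in> ext cl A then \<epsilon> i else 1) (ext cl {1..n})"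
    have "({1..n}, ?\<delta>) \<in> carrier Q0" using full_closed A by (auto simp: PiE_iff)
    then have "\<not> ({1..n}, ?\<delta>) \<sqsubset>\<^bsub>Q0\<^esub> (A, \<epsilon>)" using that A by auto
    then have "A = {1..n}"
      using lless_Q0[OF \<open>({1..n}, ?\<delta>) \<in> carrier Q0\<close>, of A \<epsilon>] closedD(1)[OF A(2)] x A(1) by auto
    then show ?thesis using A by simp
  qed
  have cov: "?r y = ?r x + 1" if xy: "covered_by Q0 x y" for x y
  proof -
    obtain A \<epsilon> B \<delta> where xy': "x = (B, \<delta>)" "y = (A, \<epsilon>)"
      by (metis prod.exhaust)
    have carr: "(B, \<delta>) \<in> carrier Q0" "(A, \<epsilon>) \<in> carrier Q0" and less: "(B, \<delta>) \<sqsubset>\<^bsub>Q0\<^esub> (A, \<epsilon>)"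
      using xy unfolding xy' covered_by_def by blast+
    then have AB: "A \<in> closeds" "B \<in> closeds" "A \<subset> B" and agree: "\<forall>i \<in> ext cl A \<inter> ext cl B. \<epsilon> i = \<delta> i"
      using less lless_Q0[OF carr] by auto
    have no: "\<not> (\<exists>C \<in> closeds. A \<subset> C \<and> C \<subset> B)"
    proof (intro notI, elim bexE conjE)
      fix C assume C: "C \<in> closeds" "A \<subset> C" "C \<subset> B"
      \<comment> \<open>A signing of \<open>C\<close> compatible with both neighbours:
        \<open>\<epsilon>\<close> takes precedence, which is harmless since
        \<open>\<epsilon>\<close> and \<open>\<delta>\<close> agree on indices extreme in both
        \<open>A\<close> and \<open>B\<close>. So covers of signed sets project to covers of closed
        sets.\<close>
      define \<eta> where "\<eta> = restrict (\<lambda>i. if i \<in> ext cl A then \<epsilon> i else if i \<in> ext cl B then \<delta> i else 1) (ext cl C)"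
      have C': "(C, \<eta>) \<in> carrier Q0" using C carr by (auto simp: \<eta>_def PiE_iff)
      have "(B, \<delta>) \<sqsubset>\<^bsub>Q0\<^esub> (C, \<eta>)"
        unfolding lless_Q0[OF carr(1) C'] using C(3) agree by (auto simp: \<eta>_def)
      moreover have "(C, \<eta>) \<sqsubset>\<^bsub>Q0\<^esub> (A, \<epsilon>)"
        unfolding lless_Q0[OF C' carr(2)] using C(2) by (auto simp: \<eta>_def)
      ultimately show False using C' xy unfolding xy' covered_by_def by blast
    qed
    obtain i where i: "i \<in> ext cl B" "A = B - {i}"
      using between_closed[OF AB(2,1,3) no] by metis
    have "card B \<le> n" using closedD[OF AB(2)] card_mono[of "{1..n}" B] by simp
    moreover have "i \<in> B" "finite B" using i ext_subset[OF AB(2)] closedD[OF AB(2)] by auto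
    ultimately show ?thesis
      using i card_gt_0_iff[of B] by (auto simp: xy' card_Diff_singleton)
  qed
  have fin: "finite (carrier Q0)" "({}, \<lambda>_. undefined) \<in> carrier Q0"
    using finite_closed finite_ext empty_closed by (auto simp: ext_empty intro!: finite_SigmaI finite_PiE)
  note * = graded_adjoin_bottom[where P = Q0 and \<rho> = ?r and t = "({}, \<lambda>_. undefined)",
      OF partial_order_Q0 fin _ min cov]
  show "graded (adjoin_bottom Q0)" by (rule *(1)) (auto simp: ext_empty)
  show "\<bottom>\<^bsub>adjoin_bottom Q0\<^esub> = None" by (rule *(3)) (auto simp: ext_empty)
  show "\<top>\<^bsub>adjoin_bottom Q0\<^esub> = Some ({}, \<lambda>_. undefined)" by (rule *(4)) (auto simp: ext_empty)
  show "(A, \<epsilon>) \<in> carrier Q0 \<Longrightarrow> rank (adjoin_bottom Q0) (Some (A, \<epsilon>)) = n - card A + 1"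
    by (subst *(2)) (auto simp: ext_empty)
qed

text \<open>Indices of \<open>ext cl A\<close> inside \<open>B\<close> are extreme in
  \<open>B\<close> and inherit their sign from \<open>\<delta>\<close>; those in
  \<open>ext cl A - B\<close> are free.\<close>

lemma card_signed_below:
  assumes A: "A \<in> closeds" and B: "B \<in> closeds" "B \<subset> A" and \<delta>: "\<delta> \<in> ext cl B \<rightarrow>\<^sub>E {-1, 1}"
  shows "card {t \<in> carrier (adjoin_bottom Q0). t \<sqsubset>\<^bsub>adjoin_bottom Q0\<^esub> Some (B, \<delta>) \<and>
    map_option fst t = Some A} = 2 ^ card (ext cl A - B)" (is "card ?S = _")
proof -
  let ?T = "\<lambda>i. if i \<in> B then {\<delta> i} else {-1, 1}"
  have Bd: "(B, \<delta>) \<in> carrier Q0" using B \<delta> by auto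
  have ext_iff: "i \<in> ext cl B \<longleftrightarrow> i \<in> B" if "i \<in> ext cl A" for i
    using that ext_restrict[OF A B(1)] B(2) ext_subset[OF B(1)] by blast
  have img: "?S = (\<lambda>\<epsilon>. Some (A, \<epsilon>)) ` (\<Pi>\<^sub>E i \<in> ext cl A. ?T i)"
  proof (intro Set.set_eqI iffI)
    fix t assume "t \<in> ?S"
    then obtain \<epsilon> where t: "t = Some (A, \<epsilon>)" "(A, \<epsilon>) \<in> carrier Q0" "(A, \<epsilon>) \<sqsubset>\<^bsub>Q0\<^esub> (B, \<delta>)" by auto
    then have "\<forall>i \<in> ext cl B \<inter> ext cl A. \<delta> i = \<epsilon> i" using lless_Q0[OF t(2) Bd] by simp
    then have "\<epsilon> \<in> (\<Pi>\<^sub>E i \<in> ext cl A. ?T i)" using t(2) ext_iff by (auto simp: PiE_iff)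
    then show "t \<in> (\<lambda>\<epsilon>. Some (A, \<epsilon>)) ` (\<Pi>\<^sub>E i \<in> ext cl A. ?T i)" using t by blast
  next
    fix t assume "t \<in> (\<lambda>\<epsilon>. Some (A, \<epsilon>)) ` (\<Pi>\<^sub>E i \<in> ext cl A. ?T i)"
    then obtain \<epsilon> where t: "t = Some (A, \<epsilon>)" and \<epsilon>: "\<epsilon> \<in> (\<Pi>\<^sub>E i \<in> ext cl A. ?T i)" by blast
    have T: "?T i \<subseteq> {-1, 1}" if "i \<in> ext cl A" for i
      using \<delta> ext_iff[OF that] by (auto simp: PiE_iff)
    have "\<epsilon> i \<in> {-1, 1}" if "i \<in> ext cl A" for i
      using T[OF that] PiE_mem[OF \<epsilon> that] by blast
    then have "\<epsilon> \<in> ext cl A \<rightarrow>\<^sub>E {-1, 1}" using \<epsilon> by (auto simp: PiE_iff)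
    then have Ae: "(A, \<epsilon>) \<in> carrier Q0" using A by simp
    have "\<delta> i = \<epsilon> i" if "i \<in> ext cl B" "i \<in> ext cl A" for i
      using PiE_mem[OF \<epsilon> that(2)] that ext_iff by simp
    then have "(A, \<epsilon>) \<sqsubset>\<^bsub>Q0\<^esub> (B, \<delta>)" using lless_Q0[OF Ae Bd] B(2) by auto
    then show "t \<in> ?S" using Ae t by simp
  qed
  have "card ?S = card (\<Pi>\<^sub>E i \<in> ext cl A. ?T i)"
    unfolding img by (rule card_image) (simp add: inj_on_def)
  also have "\<dots> = (\<Prod>i \<in> ext cl A. if i \<in> B then 1 else 2)"
    using finite_ext[OF A] by (subst card_PiE) (auto intro!: prod.cong)
  also have "\<dots> = 2 ^ card (ext cl A - B)"
    using finite_ext[OF A] by (simp add: prod.If_cases Diff_eq)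
  finally show ?thesis .
qed

section \<open>Sign classes and their representatives\<close>

definition sign_class :: "nat set \<times> (nat \<Rightarrow> int) \<Rightarrow> (nat set \<times> (nat \<Rightarrow> int)) set" where
  "sign_class x = {y \<in> signed_pairs n cl. fst y = fst x \<and> (\<forall>i \<in> ext cl (fst x). snd y i = snd x i)}"

lemma sign_class_iff: "(A', \<epsilon>') \<in> sign_class (A, \<epsilon>) \<longleftrightarrow>
    (A', \<epsilon>') \<in> signed_pairs n cl \<and> A' = A \<and> (\<forall>i \<in> ext cl A. \<epsilon>' i = \<epsilon> i)"
  by (simp add: sign_class_def)

lemma poset_iso_Q0: "poset_iso Q0 (signed_poset n cl) sign_class" (is "poset_iso _ ?Q ?h")
proof -
  have ne: "\<exists>\<epsilon>'. (A, \<epsilon>') \<in> ?h (A, \<epsilon>)" if "(A, \<epsilon>) \<in> carrier Q0" for A \<epsilon>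
  proof -
    \<comment> \<open>Extends \<open>\<epsilon>\<close> from the extreme points to all of
      \<open>{1..n}\<close> by the filler 1. The class is thus nonempty, as the existential order of
      \<open>signed_poset\<close> requires.\<close>
    have "(A, restrict (\<lambda>i. if i \<in> ext cl A then \<epsilon> i else 1) {1..n}) \<in> ?h (A, \<epsilon>)"
      using that ext_subset[of A] closedD(1)[of A]
      by (auto simp: sign_class_iff signed_pairs_def PiE_iff subset_iff)
    then show ?thesis by blast
  qed
  have le: "?h x \<sqsubseteq>\<^bsub>?Q\<^esub> ?h y \<longleftrightarrow> x \<sqsubseteq>\<^bsub>Q0\<^esub> y" if carr: "x \<in> carrier Q0" "y \<in> carrier Q0" for x y
  proof -
    obtain A \<epsilon> B \<delta> where xy: "x = (B, \<delta>)" "y = (A, \<epsilon>)" by (metis prod.exhaust)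
    obtain \<epsilon>' \<delta>' where rep: "(A, \<epsilon>') \<in> ?h (A, \<epsilon>)" "(B, \<delta>') \<in> ?h (B, \<delta>)"
      using ne carr unfolding xy by blast
    have "?h (B, \<delta>) \<sqsubseteq>\<^bsub>?Q\<^esub> ?h (A, \<epsilon>) \<longleftrightarrow> (\<exists>(B', \<delta>') \<in> ?h (B, \<delta>). \<exists>(A', \<epsilon>') \<in> ?h (A, \<epsilon>).
        A' \<subseteq> B' \<and> (\<forall>i \<in> ext cl A' \<inter> ext cl B'. \<epsilon>' i = \<delta>' i))"
      by (simp add: signed_poset_def)
    also have "\<dots> \<longleftrightarrow> A \<subseteq> B \<and> (\<forall>i \<in> ext cl A \<inter> ext cl B. \<epsilon> i = \<delta> i)"
    proof
      assume "A \<subseteq> B \<and> (\<forall>i \<in> ext cl A \<inter> ext cl B. \<epsilon> i = \<delta> i)"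
      then show "\<exists>(B', \<delta>') \<in> ?h (B, \<delta>). \<exists>(A', \<epsilon>') \<in> ?h (A, \<epsilon>).
          A' \<subseteq> B' \<and> (\<forall>i \<in> ext cl A' \<inter> ext cl B'. \<epsilon>' i = \<delta>' i)"
        using rep by (intro bexI[OF _ rep(2)], simp only: prod.case, intro bexI[OF _ rep(1)])
          (auto simp: sign_class_iff)
    qed (auto simp: sign_class_iff)
    finally show ?thesis by (simp add: xy)
  qed
  have eqv: "sign_equiv n cl `` {(A, \<epsilon>)} = ?h (A, restrict \<epsilon> (ext cl A))"
    if "(A, \<epsilon>) \<in> signed_pairs n cl" for A \<epsilon>
  proof (rule Set.set_eqI)
    fix y :: "nat set \<times> (nat \<Rightarrow> int)"
    obtain A' \<epsilon>' where y: "y = (A', \<epsilon>')" by (metis prod.exhaust)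
    show "y \<in> sign_equiv n cl `` {(A, \<epsilon>)} \<longleftrightarrow> y \<in> ?h (A, restrict \<epsilon> (ext cl A))"
      using that unfolding y sign_equiv_def Image_singleton_iff mem_Collect_eq prod.case sign_class_iff
      by auto
  qed
  have carr: "carrier ?Q = ?h ` carrier Q0"
  proof (intro Set.set_eqI iffI)
    fix X assume "X \<in> carrier ?Q"
    then obtain A \<epsilon> where X: "X = sign_equiv n cl `` {(A, \<epsilon>)}" "(A, \<epsilon>) \<in> signed_pairs n cl"
      by (auto simp: signed_poset_def quotient_def)
    then have "(A, restrict \<epsilon> (ext cl A)) \<in> carrier Q0"
      using ext_subset[of A] closedD(1)[of A] by (auto simp: signed_pairs_def PiE_iff subset_iff)
    then show "X \<in> ?h ` carrier Q0" using eqv[OF X(2)] X(1) by blast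
  next
    fix X assume "X \<in> ?h ` carrier Q0"
    then obtain A \<epsilon> where X: "X = ?h (A, \<epsilon>)" "(A, \<epsilon>) \<in> carrier Q0" by (metis imageE prod.exhaust)
    obtain \<epsilon>' where e: "(A, \<epsilon>') \<in> ?h (A, \<epsilon>)" using ne X by blast
    then have p: "(A, \<epsilon>') \<in> signed_pairs n cl" by (simp add: sign_class_iff)
    have "restrict \<epsilon>' (ext cl A) = \<epsilon>"
      using e X(2) by (auto simp: sign_class_iff PiE_iff extensional_def restrict_def fun_eq_iff)
    then have "X = sign_equiv n cl `` {(A, \<epsilon>')}" using eqv[OF p] X by simp
    then show "X \<in> carrier ?Q" using p by (auto simp: signed_poset_def quotient_def)
  qed
  show ?thesis
    by (rule poset_isoI[OF partial_order_Q0 _ carr le]) (simp add: signed_poset_def)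
qed

text \<open>The number of elements over the first argument below a fixed element over the second.
  The fibre over \<open>None\<close> is \<open>{None}\<close>, whence the value 1.\<close>

fun sign_lifts :: "nat set option \<Rightarrow> nat set option \<Rightarrow> rat" where
  "sign_lifts (Some A) (Some B) = 2 ^ card (ext cl A - B)"
| "sign_lifts _ _ = 1"

text \<open>Forgetting signs is the projection for \<open>chain_series_fibration\<close>: chains
  upstairs have weight 1, and the fibre count becomes the weight downstairs.\<close>

lemma F_Q_poset: "F (Q_poset n cl) = chain_series M sign_lifts"
proof -
  interpret iso: poset_iso "adjoin_bottom Q0" "Q_poset n cl" "map_option sign_class"
    unfolding Q_poset_def by (rule poset_iso.poset_iso_adjoin_bottom) (rule poset_iso_Q0)
  interpret G: graded "adjoin_bottom Q0" by (rule graded_Q0)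
  interpret C: partial_order "closed_poset n cl" by (rule partial_order_closed_poset)
  have "F (Q_poset n cl) = F (adjoin_bottom Q0)"
    using iso.F_image graded_Q0 by simp
  also have "\<dots> = chain_series M sign_lifts"
    unfolding F_def
  proof (rule chain_series_fibration[where \<pi> = "map_option fst"])
    fix s u assume s: "s \<in> carrier M" and u: "u \<in> carrier (adjoin_bottom Q0)"
      and less: "s \<sqsubset>\<^bsub>M\<^esub> map_option fst u"
    let ?S = "{t \<in> carrier (adjoin_bottom Q0). t \<sqsubset>\<^bsub>adjoin_bottom Q0\<^esub> u \<and> map_option fst t = s}"
    obtain B \<delta> where u': "u = Some (B, \<delta>)" "B \<in> closeds" "\<delta> \<in> ext cl B \<rightarrow>\<^sub>E {-1, 1}"
      using u less by auto
    show "(\<Sum>t \<in> ?S. 1) = sign_lifts s (map_option fst u)"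
    proof (cases s)
      case None
      then have "?S = {None}" using u' by auto
      then show ?thesis using None by simp
    next
      case (Some A)
      then have "A \<in> closeds" "B \<subset> A" using s less u' by auto
      then show ?thesis using card_signed_below[OF _ u'(2) _ u'(3)] u' Some by simp
    qed
  next
    fix t u assume "t \<in> carrier (adjoin_bottom Q0)" "u \<in> carrier (adjoin_bottom Q0)"
      "t \<sqsubset>\<^bsub>adjoin_bottom Q0\<^esub> u"
    then show "map_option fst t \<sqsubset>\<^bsub>M\<^esub> map_option fst u"
      using lless_Q0 by (cases t; cases u) auto
  next
    fix t assume "t \<in> carrier (adjoin_bottom Q0)"
    then show "rank M (map_option fst t) = rank (adjoin_bottom Q0) t"
      using M.rank_bottom G.rank_bottom
      by (auto simp: graded_M graded_Q0)
  qed (auto simp: graded_M graded_Q0)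
  finally show ?thesis .
qed

lemma theta_F_closed:
  assumes "is_theta \<theta>"
  shows "\<theta> (F M) m = 2 * F (Q_poset n cl) m"
proof -
  let ?\<nu> = "\<lambda>s t. rat_of_int (nu (interval M s t))"
  interpret C: partial_order "closed_poset n cl" by (rule partial_order_closed_poset)
  have weight: "chain_weight ?\<nu> ts = 2 * chain_weight sign_lifts ts" if ts: "bounded_chain M ts" for ts
  proof -
    \<comment> \<open>Minimum \<open>None\<close> and maximum \<open>Some {}\<close> differ, so a
      bounded chain has a first step out of \<open>None\<close>.\<close>
    have "ts = None # tl ts" "tl ts \<noteq> []"
      using ts by (cases ts; auto simp: bounded_chain_def graded_M)+
    then obtain us where us: "ts = None # us" "us \<noteq> []" by blast
    have "hd us \<in> carrier M" "None \<sqsubset>\<^bsub>M\<^esub> hd us"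
      using ts us by (cases us; auto simp: bounded_chain_def)+
    then obtain B where B: "hd us = Some B" "B \<in> closeds" by auto
    \<comment> \<open>Beyond the first step the weights coincide; the first step weighs 2 against
      1.\<close>
    have "chain_weight ?\<nu> us = chain_weight sign_lifts us"
    proof (rule chain_weight_cong[where R = "(\<sqsubset>\<^bsub>M\<^esub>)"])
      show "sorted_wrt (\<sqsubset>\<^bsub>M\<^esub>) us" using ts us by (simp add: bounded_chain_def)
      fix s t assume "s \<in> set us" "t \<in> set us" and st: "s \<sqsubset>\<^bsub>M\<^esub> t"
      then have "None \<sqsubset>\<^bsub>M\<^esub> s" "s \<in> carrier M" "t \<in> carrier M"
        using ts us by (auto simp: bounded_chain_def)
      then obtain A B where "s = Some A" "t = Some B" "A \<in> closeds" "B \<in> closeds" "B \<subseteq> A"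
        using st by auto
      then show "?\<nu> s t = sign_lifts s t" by (simp add: nu_interval_closed)
    qed
    then show ?thesis
      using us B by (simp add: chain_weight_Cons nu_interval_bottom)
  qed
  have "\<theta> (F M) m = (\<Sum>(ts, is) \<in> chain_terms M m. chain_weight ?\<nu> ts)"
    unfolding theta_F[OF assms graded_M(1)] by (rule chain_series_eq)
  also have "\<dots> = (\<Sum>(ts, is) \<in> chain_terms M m. 2 * chain_weight sign_lifts ts)"
    by (rule sum.cong) (auto simp: chain_terms_def weight)
  also have "\<dots> = 2 * chain_series M sign_lifts m"
    unfolding chain_series_eq sum_distrib_left by (simp add: case_prod_unfold)
  finally show ?thesis unfolding F_Q_poset .
qed

end

section \<open>Meet-distributive lattices\<close>

locale meet_distributive_lattice = lattice K + finite_poset K for K (structure) +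
  assumes nonempty: "carrier K \<noteq> {}"
    and distributive: "\<lbrakk>y \<in> carrier K; y \<noteq> \<bottom>\<rbrakk> \<Longrightarrow>
      boolean_algebra (interval K (\<Sqinter> {x. covered_by K x y}) y)"
begin

lemma bottom_least: "\<bottom> \<in> carrier K" "x \<in> carrier K \<Longrightarrow> \<bottom> \<sqsubseteq> x"
proof -
  have "greatest K (\<Sqinter> (carrier K)) (Lower K (carrier K))"
    using finite_carrier nonempty by (intro finite_inf_greatest) auto
  then have "least K (\<Sqinter> (carrier K)) (carrier K)"
    by (auto simp: least_def greatest_def Lower_def)
  then have "least K \<bottom> (carrier K)" unfolding bottom_def by (rule someI)
  then show "\<bottom> \<in> carrier K" "x \<in> carrier K \<Longrightarrow> \<bottom> \<sqsubseteq> x" by (auto simp: least_def)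
qed

lemma coveredD:
  assumes "covered_by K z y"
  shows "z \<in> carrier K" "y \<in> carrier K" "z \<sqsubseteq> y" "z \<noteq> y" "z \<sqsubset> y"
    and "\<lbrakk>w \<in> carrier K; z \<sqsubseteq> w; w \<sqsubseteq> y\<rbrakk> \<Longrightarrow> w = z \<or> w = y"
  using assms by (auto simp: covered_by_def lless_eq)

text \<open>Coordinates on the Boolean interval below \<open>y\<close> in which the lower covers of \<open>y\<close> are the
  complements of points.\<close>

lemma coatom_coordinates:
  assumes "covered_by K z\<^sub>0 y"
  obtains m f and k :: nat where "m \<in> carrier K" "\<And>z. covered_by K z y \<Longrightarrow> m \<sqsubseteq> z"
    and "bij_betw f {x \<in> carrier K. m \<sqsubseteq> x \<and> x \<sqsubseteq> y} (Pow {1..k})"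
    and "\<And>u v. \<lbrakk>u \<in> carrier K; v \<in> carrier K; m \<sqsubseteq> u; u \<sqsubseteq> y; m \<sqsubseteq> v; v \<sqsubseteq> y\<rbrakk> \<Longrightarrow> u \<sqsubseteq> v \<longleftrightarrow> f u \<subseteq> f v"
    and "\<And>z. covered_by K z y \<Longrightarrow> \<exists>p \<in> {1..k}. f z = {1..k} - {p}"
proof -
  let ?C = "{x. covered_by K x y}"
  let ?m = "\<Sqinter> ?C"
  have C: "finite ?C" "?C \<subseteq> carrier K" "?C \<noteq> {}"
    using finite_subset[OF _ finite_carrier, of ?C] assms by (auto simp: covered_by_def)
  have "greatest K ?m (Lower K ?C)" using C by (rule finite_inf_greatest)
  then have m: "?m \<in> carrier K" "\<And>z. covered_by K z y \<Longrightarrow> ?m \<sqsubseteq> z"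
    using C(2) by (auto simp: greatest_def Lower_def)
  note y = coveredD[OF assms]
  have "y \<noteq> \<bottom>" using y bottom_least(2)[of z\<^sub>0] le_antisym by blast
  then obtain k :: nat and f where f:
    "bij_betw f (carrier (interval K ?m y)) (Pow {1..k})"
    "\<forall>u \<in> carrier (interval K ?m y). \<forall>v \<in> carrier (interval K ?m y).
      u \<sqsubseteq>\<^bsub>interval K ?m y\<^esub> v \<longleftrightarrow> f u \<subseteq> f v"
    using distributive[OF y(2)] unfolding boolean_algebra_def by blast
  have bij: "bij_betw f {x \<in> carrier K. ?m \<sqsubseteq> x \<and> x \<sqsubseteq> y} (Pow {1..k})"
    using f(1) by (simp only: interval_simps)
  have le: "u \<sqsubseteq> v \<longleftrightarrow> f u \<subseteq> f v"
    if "u \<in> carrier K" "v \<in> carrier K" "?m \<sqsubseteq> u" "u \<sqsubseteq> y" "?m \<sqsubseteq> v" "v \<sqsubseteq> y" for u v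
    using that f(2) unfolding interval_simps by blast
  have my: "?m \<sqsubseteq> y" by (rule le_trans[OF m(2)[OF assms] y(3) m(1) y(1,2)])
  have sub: "f u \<subseteq> {1..k}" if "u \<in> carrier K" "?m \<sqsubseteq> u" "u \<sqsubseteq> y" for u
    using bij that unfolding bij_betw_def by blast
  have onto: "\<exists>u. u \<in> carrier K \<and> ?m \<sqsubseteq> u \<and> u \<sqsubseteq> y \<and> f u = S" if "S \<subseteq> {1..k}" for S
  proof -
    have "S \<in> f ` {x \<in> carrier K. ?m \<sqsubseteq> x \<and> x \<sqsubseteq> y}" using bij that unfolding bij_betw_def by simp
    then show ?thesis by blast
  qed
  have fy: "f y = {1..k}"
  proof -
    obtain u where u: "u \<in> carrier K" "?m \<sqsubseteq> u" "u \<sqsubseteq> y" "f u = {1..k}" using onto by blast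
    then have "f u \<subseteq> f y" using le[of u y] y(2) my by simp
    then show ?thesis using u(4) sub[of y] y(2) my by auto
  qed
  have coatom: "\<exists>p \<in> {1..k}. f z = {1..k} - {p}" if z: "covered_by K z y" for z
  proof -
    note z' = coveredD[OF z] m(2)[OF z]
    have "\<not> y \<sqsubseteq> z" using z' le_antisym by blast
    then have "\<not> f y \<subseteq> f z" using le[of y z] z' my by simp
    then obtain p where p: "p \<in> {1..k}" "p \<notin> f z" using fy by blast
    \<comment> \<open>The element whose coordinates omit only \<open>p\<close> is above
      \<open>z\<close> and below \<open>y\<close> without being \<open>y\<close>; as
      \<open>y\<close> covers \<open>z\<close>, it is \<open>z\<close>.\<close>
    obtain w where w: "w \<in> carrier K" "?m \<sqsubseteq> w" "w \<sqsubseteq> y" "f w = {1..k} - {p}"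
      using onto[of "{1..k} - {p}"] by blast
    have "f z \<subseteq> f w" using p w(4) sub[of z] z' by blast
    then have "z \<sqsubseteq> w" using le[of z w] z' w by simp
    moreover have "w \<noteq> y"
    proof
      assume "w = y"
      then have "p \<in> {1..k} - {p}" using w(4) fy p(1) by simp
      then show False by blast
    qed
    ultimately have "w = z" using z'(6)[of w] w by blast
    then show ?thesis using p(1) w(4) by blast
  qed
  show ?thesis by (rule that[OF m bij le coatom])
qed

text \<open>In coordinates each lower cover of \<open>y\<close> omits one point, and the meet of two
  omits their two points. So the meet is one step below \<open>z1\<close>, and a third lower cover,
  omitting another point, is not above it.\<close>

lemma meet_coatoms:
  assumes z1: "covered_by K z1 y" and z2: "covered_by K z2 y" and ne: "z1 \<noteq> z2"
  shows "covered_by K (z1 \<sqinter> z2) z1"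
    and "\<lbrakk>covered_by K z3 y; z3 \<noteq> z1; z3 \<noteq> z2\<rbrakk> \<Longrightarrow> \<not> z1 \<sqinter> z2 \<sqsubseteq> z3"
proof -
  obtain m f k where m: "m \<in> carrier K" "\<And>z. covered_by K z y \<Longrightarrow> m \<sqsubseteq> z"
    and bij: "bij_betw f {x \<in> carrier K. m \<sqsubseteq> x \<and> x \<sqsubseteq> y} (Pow {1..k::nat})"
    and le: "\<And>u v. \<lbrakk>u \<in> carrier K; v \<in> carrier K; m \<sqsubseteq> u; u \<sqsubseteq> y; m \<sqsubseteq> v; v \<sqsubseteq> y\<rbrakk> \<Longrightarrow>
      u \<sqsubseteq> v \<longleftrightarrow> f u \<subseteq> f v"
    and coatom: "\<And>z. covered_by K z y \<Longrightarrow> \<exists>p \<in> {1..k}. f z = {1..k} - {p}"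
    by (rule coatom_coordinates[OF z1]) (rule that; assumption)
  note z1' = coveredD[OF z1] m(2)[OF z1] and z2' = coveredD[OF z2] m(2)[OF z2]
  have inj: "u = v" if "u \<in> carrier K" "v \<in> carrier K" "m \<sqsubseteq> u" "u \<sqsubseteq> y" "m \<sqsubseteq> v" "v \<sqsubseteq> y" "f u = f v" for u v
    using le[of u v] le[of v u] that le_antisym by simp
  let ?w = "z1 \<sqinter> z2"
  have w: "?w \<in> carrier K" "?w \<sqsubseteq> z1" "?w \<sqsubseteq> z2" "m \<sqsubseteq> ?w"
    using z1' z2' m(1) by (auto intro: meet_left meet_right meet_le)
  have wy: "?w \<sqsubseteq> y" by (rule le_trans[OF w(2) z1'(3) w(1) z1'(1,2)])
  obtain p1 p2 where p: "p1 \<in> {1..k}" "f z1 = {1..k} - {p1}" "p2 \<in> {1..k}" "f z2 = {1..k} - {p2}"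
    using coatom z1 z2 by metis
  have p_ne: "p1 \<noteq> p2" using ne inj[of z1 z2] z1' z2' p by auto
  \<comment> \<open>The meet is formed in \<open>K\<close> and not in the interval, so it is
    compared with the element \<open>v\<close> that has the expected coordinates.\<close>
  have fw: "f ?w = {1..k} - {p1, p2}"
  proof -
    have "{1..k} - {p1, p2} \<in> f ` {x \<in> carrier K. m \<sqsubseteq> x \<and> x \<sqsubseteq> y}"
      using bij unfolding bij_betw_def by simp
    then obtain v where v: "v \<in> carrier K" "m \<sqsubseteq> v" "v \<sqsubseteq> y" "f v = {1..k} - {p1, p2}" by blast
    have "v \<sqsubseteq> z1" "v \<sqsubseteq> z2"
      using le[of v z1] le[of v z2] v z1' z2' p by auto
    then have "v \<sqsubseteq> ?w" using v(1) z1'(1) z2'(1) by (intro meet_le)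
    then have "f v \<subseteq> f ?w" using le[of v ?w] v w wy by simp
    moreover have "f ?w \<subseteq> f z1" "f ?w \<subseteq> f z2"
      using le[of ?w z1] le[of ?w z2] w wy z1' z2' by auto
    ultimately show ?thesis using v(4) p by auto
  qed
  show "covered_by K ?w z1"
    unfolding covered_by_def
  proof (intro conjI notI)
    show "?w \<in> carrier K" "z1 \<in> carrier K" using w z1' by auto
    have "p2 \<in> f z1" "p2 \<notin> f ?w" using fw p p_ne by simp_all
    then have "?w \<noteq> z1" by metis
    then show "?w \<sqsubset> z1" using w(2) by (simp add: lless_eq)
    assume "\<exists>v \<in> carrier K. ?w \<sqsubset> v \<and> v \<sqsubset> z1"
    then obtain v where v: "v \<in> carrier K" "?w \<sqsubseteq> v" "?w \<noteq> v" "v \<sqsubseteq> z1" "v \<noteq> z1"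
      by (auto simp: lless_eq)
    have v': "m \<sqsubseteq> v" "v \<sqsubseteq> y" 
      using le_trans[OF w(4) v(2) m(1) w(1) v(1)] le_trans[OF v(4) z1'(3) v(1) z1'(1,2)] by auto
    have "f ?w \<subseteq> f v" "f v \<subseteq> f z1" using le[of ?w v] le[of v z1] v v' w wy z1' by auto
    moreover have "f ?w \<noteq> f v" "f v \<noteq> f z1" using inj[of ?w v] inj[of v z1] v v' w wy z1' by auto
    ultimately show False unfolding fw p(2) by blast
  qed
  assume z3: "covered_by K z3 y" "z3 \<noteq> z1" "z3 \<noteq> z2"
  note z3' = coveredD[OF z3(1)] m(2)[OF z3(1)]
  obtain p3 where p3: "p3 \<in> {1..k}" "f z3 = {1..k} - {p3}" using coatom z3(1) by metis
  have "p3 \<noteq> p1" "p3 \<noteq> p2" using inj[of z3 z1] inj[of z3 z2] z3 z3' z1' z2' p p3 by auto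
  then have "\<not> f ?w \<subseteq> f z3" unfolding fw p3(2) using p3(1) by blast
  then show "\<not> ?w \<sqsubseteq> z3" using le[of ?w z3] w wy z3' by simp
qed

section \<open>Join-irreducibles and lower covers\<close>

abbreviation "JI \<equiv> join_irreducibles K"

lemma JI_closed: "j \<in> JI \<Longrightarrow> j \<in> carrier K"
  by (simp add: join_irreducibles_def)

text \<open>Induction on \<open>x\<close>: an element that is neither \<open>\<bottom>\<close> nor
  join-irreducible is the join of two strictly smaller ones.\<close>

lemma JI_dense:
  assumes "x \<in> carrier K" "y \<in> carrier K" "\<And>j. j \<in> JI \<Longrightarrow> j \<sqsubseteq> x \<Longrightarrow> j \<sqsubseteq> y"
  shows "x \<sqsubseteq> y"
  using assms(1,3)
proof (induction x rule: lless_induct)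
  case (less x)
  show ?case
  proof (cases "x = \<bottom> \<or> x \<in> JI")
    case True
    then show ?thesis using less assms(2) bottom_least(2) by auto
  next
    case False
    then obtain a b where ab: "a \<in> carrier K" "b \<in> carrier K" "x = a \<squnion> b" "x \<noteq> a" "x \<noteq> b"
      using less(1) by (auto simp: join_irreducibles_def)
    then have "a \<sqsubset> x" "b \<sqsubset> x" using join_left[of a b] join_right[of a b] by (auto simp: lless_eq)
    moreover have "j \<sqsubseteq> y" if "j \<in> JI" "j \<sqsubseteq> a \<or> j \<sqsubseteq> b" for j
      using that less(1) less.prems \<open>a \<sqsubset> x\<close> \<open>b \<sqsubset> x\<close> ab JI_closed
      by (metis le_trans lless_eq)
    ultimately have "a \<sqsubseteq> y" "b \<sqsubseteq> y" using less.IH ab by blast+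
    then show ?thesis using ab assms(2) join_le by simp
  qed
qed

text \<open>The join of two different lower covers of \<open>y\<close> is \<open>y\<close>
  itself.\<close>

lemma JI_unique_lower_cover:
  assumes "y \<in> JI" "covered_by K z y" "covered_by K z' y"
  shows "z = z'"
proof (rule ccontr)
  assume ne: "z \<noteq> z'"
  note z = coveredD[OF assms(2)] and z' = coveredD[OF assms(3)]
  have c: "z \<squnion> z' \<in> carrier K" "z \<sqsubseteq> z \<squnion> z'" "z' \<sqsubseteq> z \<squnion> z'" "z \<squnion> z' \<sqsubseteq> y"
    using z z' by (auto intro: join_left join_right join_le)
  then have "z \<squnion> z' = z \<or> z \<squnion> z' = y" using z(6) by blast
  moreover have "z \<squnion> z' \<noteq> z"
    using c z'(6)[of z] z z' ne by auto
  ultimately have "y = z \<squnion> z'" by simp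
  moreover have "\<forall>a \<in> carrier K. \<forall>b \<in> carrier K. y = a \<squnion> b \<longrightarrow> y = a \<or> y = b"
    using assms(1) by (simp add: join_irreducibles_def)
  ultimately have "y = z \<or> y = z'" using z(1) z'(1) by blast
  then show False using z z' by auto
qed

text \<open>Otherwise \<open>i\<close> and \<open>j\<close> lie below lower covers \<open>z1\<close>, \<open>z2\<close> of \<open>y\<close> other than \<open>z\<close>. As the
  interval below \<open>y\<close> is Boolean, some join-irreducible is below \<open>z1 \<sqinter> z2\<close> but not below \<open>z\<close>,
  and by induction it equals both.\<close>

lemma JI_below_not_below_unique:
  assumes "covered_by K z y" "i \<in> JI" "j \<in> JI" "i \<sqsubseteq> y" "j \<sqsubseteq> y" "\<not> i \<sqsubseteq> z" "\<not> j \<sqsubseteq> z"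
  shows "i = j"
proof -
  have "y \<in> carrier K" using assms(1) by (simp add: covered_by_def)
  then show ?thesis
    using assms
  proof (induction y arbitrary: z i j rule: lless_induct)
    case (less y)
    note z = coveredD[OF less.prems(1)]
    have other: "\<exists>z'. covered_by K z' y \<and> z' \<noteq> z \<and> l \<sqsubseteq> z'"
      if l: "l \<in> JI" "l \<sqsubseteq> y" "\<not> l \<sqsubseteq> z" "l \<noteq> y" for l
    proof -
      have "l \<sqsubset> y" using l by (simp add: lless_eq)
      then obtain z' where "l \<sqsubseteq> z'" "covered_by K z' y"
        using obtain_lower_cover[of l y] JI_closed[OF l(1)] less(1) by blast
      then show ?thesis using l by blast
    qed
    show ?case
    proof (cases "y \<in> JI")
      case True
      \<comment> \<open>A join-irreducible below \<open>y\<close> other than \<open>y\<close> lies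
        below some lower cover, and here \<open>z\<close> is the only one.\<close>
      then have "l = y" if "l \<in> JI" "l \<sqsubseteq> y" "\<not> l \<sqsubseteq> z" for l
        using other[OF that] JI_unique_lower_cover[OF True less.prems(1)] by blast
      then show ?thesis using less.prems by metis
    next
      case False
      obtain z1 where z1: "covered_by K z1 y" "z1 \<noteq> z" "i \<sqsubseteq> z1" using other[of i] less.prems False by blast
      obtain z2 where z2: "covered_by K z2 y" "z2 \<noteq> z" "j \<sqsubseteq> z2" using other[of j] less.prems False by blast
      \<comment> \<open>The induction hypothesis at \<open>z'\<close>: its lower cover
        \<open>z' \<sqinter> z\<close> is above neither \<open>l\<close> nor \<open>l'\<close>,
        since these are not below \<open>z\<close>.\<close>
      have step: "l = l'" if z': "covered_by K z' y" "z' \<noteq> z" and l: "l \<in> JI" "l' \<in> JI" "l \<sqsubseteq> z'" "l' \<sqsubseteq> z'"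
        "\<not> l \<sqsubseteq> z" "\<not> l' \<sqsubseteq> z" for z' l l'
      proof (rule less.IH)
        note c = coveredD[OF z'(1)]
        show "z' \<in> carrier K" "z' \<sqsubset> y" by fact+
        show "covered_by K (z' \<sqinter> z) z'" using z' less.prems(1) by (intro meet_coatoms)
        have "z' \<sqinter> z \<sqsubseteq> z" "z' \<sqinter> z \<in> carrier K" using c z by (auto intro: meet_right)
        then show "\<not> l \<sqsubseteq> z' \<sqinter> z" "\<not> l' \<sqsubseteq> z' \<sqinter> z"
          using le_trans[of l "z' \<sqinter> z" z] le_trans[of l' "z' \<sqinter> z" z] l JI_closed z(1) by auto
      qed fact+
      show ?thesis
      proof (cases "z1 = z2")
        case True
        then show ?thesis using step[of z1 i j] z1 z2 less.prems by blast
      next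
        case False
        note c = coveredD(1)[OF z1(1)] coveredD(1)[OF z2(1)]
        have "\<not> z1 \<sqinter> z2 \<sqsubseteq> z"
          using meet_coatoms(2)[OF z1(1) z2(1) False less.prems(1)] z1 z2 by blast
        then obtain l where l: "l \<in> JI" "l \<sqsubseteq> z1 \<sqinter> z2" "\<not> l \<sqsubseteq> z"
          using JI_dense[of "z1 \<sqinter> z2" z] c z(1) by auto
        have "l \<sqsubseteq> z1" "l \<sqsubseteq> z2"
          using le_trans[OF l(2) meet_left[OF c] JI_closed[OF l(1)] meet_closed[OF c] c(1)]
            le_trans[OF l(2) meet_right[OF c] JI_closed[OF l(1)] meet_closed[OF c] c(2)] by auto
        then have "i = l" "j = l"
          using step[of z1 i l] step[of z2 j l] z1 z2 l less.prems by blast+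
        then show ?thesis by simp
      qed
    qed
  qed
qed

end

section \<open>The closure on the labels of the join-irreducibles\<close>

locale labelled_meet_distributive_lattice = meet_distributive_lattice +
  fixes n :: nat and e :: "nat \<Rightarrow> 'a"
  assumes labelling: "bij_betw e {1..n} (join_irreducibles K)"
begin

lemma e_JI: "i \<in> {1..n} \<Longrightarrow> e i \<in> JI"
  using labelling by (auto simp: bij_betw_def)

lemma e_closed: "i \<in> {1..n} \<Longrightarrow> e i \<in> carrier K"
  using e_JI JI_closed by blast

definition J :: "'a \<Rightarrow> nat set" where
  "J y = {i \<in> {1..n}. e i \<sqsubseteq> y}"

abbreviation "cl \<equiv> lattice_closure K n e"

lemma cl_eq: "cl A = J (\<Squnion> (e ` A))"
  by (simp add: lattice_closure_def J_def)

lemma J_subset_iff: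
  assumes "x \<in> carrier K" "y \<in> carrier K"
  shows "J x \<subseteq> J y \<longleftrightarrow> x \<sqsubseteq> y"
proof
  assume sub: "J x \<subseteq> J y"
  show "x \<sqsubseteq> y"
  proof (rule JI_dense[OF assms])
    fix j assume j: "j \<in> JI" "j \<sqsubseteq> x"
    then have "j \<in> e ` {1..n}" using labelling by (simp add: bij_betw_def)
    then obtain i where "i \<in> {1..n}" "j = e i" by blast
    then have "i \<in> J x" "j = e i" using j(2) by (auto simp: J_def)
    then show "j \<sqsubseteq> y" using sub by (auto simp: J_def)
  qed
next
  assume xy: "x \<sqsubseteq> y"
  show "J x \<subseteq> J y"
  proof
    fix i assume "i \<in> J x"
    then show "i \<in> J y"
      using le_trans[OF _ xy e_closed[of i] assms] by (auto simp: J_def)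
  qed
qed

text \<open>The second claim is a Galois connection between label sets and lattice elements; it
  makes the closure extensive, monotone and idempotent.\<close>

lemma sup_e:
  assumes "A \<subseteq> {1..n}"
  shows "\<Squnion> (e ` A) \<in> carrier K"
    and "y \<in> carrier K \<Longrightarrow> \<Squnion> (e ` A) \<sqsubseteq> y \<longleftrightarrow> A \<subseteq> J y"
proof -
  have A: "finite (e ` A)" "e ` A \<subseteq> carrier K"
    using assms e_closed by (auto intro: finite_subset)
  have lub: "least K (\<Squnion> (e ` A)) (Upper K (e ` A))"
  proof (cases "A = {}")
    case True
    \<comment> \<open>The empty set is bounded above by every element, so its join is the least
      element of the whole carrier.\<close>
    have "least K \<bottom> (Upper K {})" using bottom_least by (auto simp: least_def)
    then show ?thesis unfolding True sup_def image_empty by (rule someI)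
  qed (use A in \<open>auto intro: finite_sup_least\<close>)
  then show c: "\<Squnion> (e ` A) \<in> carrier K" by (rule least_closed)
  assume y: "y \<in> carrier K"
  have "e i \<sqsubseteq> \<Squnion> (e ` A)" if "i \<in> A" for i
    using least_Upper_above[OF lub] that A by blast
  then have "A \<subseteq> J y" if "\<Squnion> (e ` A) \<sqsubseteq> y"
    using le_trans[of "e _" "\<Squnion> (e ` A)" y] that c y assms e_closed by (auto simp: J_def subset_iff)
  moreover have "\<Squnion> (e ` A) \<sqsubseteq> y" if "A \<subseteq> J y"
    using that y by (intro least_le[OF lub] Upper_memI) (auto simp: J_def)
  ultimately show "\<Squnion> (e ` A) \<sqsubseteq> y \<longleftrightarrow> A \<subseteq> J y" by blast
qed

lemma J_range: "J y \<subseteq> {1..n}"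
  by (auto simp: J_def)

lemma sup_J:
  assumes "y \<in> carrier K"
  shows "\<Squnion> (e ` J y) = y"
proof (rule le_antisym)
  show "\<Squnion> (e ` J y) \<sqsubseteq> y" using sup_e(2)[OF J_range assms] by simp
  have "J y \<subseteq> J (\<Squnion> (e ` J y))" using sup_e(2)[OF J_range sup_e(1)[OF J_range], of y y] sup_e(1)[OF J_range, of y] by simp
  then show "y \<sqsubseteq> \<Squnion> (e ` J y)" using J_subset_iff assms sup_e(1)[OF J_range] by simp
qed (use assms sup_e(1)[OF J_range] in auto)

lemma closed_sets_cl: "closed_sets n cl = J ` carrier K"
proof safe
  fix A assume "A \<in> closed_sets n cl"
  then show "A \<in> J ` carrier K" using sup_e(1)[of A] by (auto simp: closed_sets_def cl_eq)
next
  fix y assume "y \<in> carrier K"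
  then have "cl (J y) = J y" unfolding cl_eq by (simp only: sup_J)
  then show "J y \<in> closed_sets n cl" using J_range[of y] unfolding closed_sets_def by blast
qed

lemma convex_closure_cl: "convex_closure n cl"
proof
  fix A B assume "A \<subseteq> B" "B \<subseteq> {1..n}"
  then have A: "A \<subseteq> {1..n}" and B: "B \<subseteq> {1..n}" and AB: "A \<subseteq> B" by auto
  have "B \<subseteq> J (\<Squnion> (e ` B))" using sup_e(2)[OF B sup_e(1)[OF B]] sup_e(1)[OF B] by simp
  then have "\<Squnion> (e ` A) \<sqsubseteq> \<Squnion> (e ` B)" using sup_e(2)[OF A sup_e(1)[OF B]] AB by simp
  then show "cl A \<subseteq> cl B" unfolding cl_eq J_subset_iff[OF sup_e(1)[OF A] sup_e(1)[OF B]] .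
next
  fix A B assume "A \<in> closed_sets n cl" "B \<in> closed_sets n cl" "A \<subset> B"
  moreover from this obtain x y where "x \<in> carrier K" "y \<in> carrier K" "A = J x" "B = J y"
    unfolding closed_sets_cl by blast
  moreover from calculation have "x \<sqsubset> y" using J_subset_iff[of x y] by (auto simp: lless_eq)
  ultimately have xy: "x \<in> carrier K" "y \<in> carrier K" "A = J x" "B = J y" "x \<sqsubset> y" by blast+
  \<comment> \<open>Passing from \<open>y\<close> to a lower cover \<open>z\<close> above
    \<open>x\<close> loses exactly one label. That label is outside \<open>J x\<close>, and deleting
    it from \<open>J y\<close> leaves the closed set \<open>J z\<close>.\<close>
  obtain z where z: "x \<sqsubseteq> z" "covered_by K z y" using obtain_lower_cover xy by blast
  note z' = coveredD[OF z(2)]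
  have "\<not> J y \<subseteq> J z" using z' le_antisym by (auto simp: J_subset_iff)
  then obtain i where i: "i \<in> J y" "i \<notin> J z" by blast
  have "l = i" if "l \<in> J y" "l \<notin> J z" for l
  proof -
    have li: "l \<in> {1..n}" "i \<in> {1..n}" "e l \<sqsubseteq> y" "e i \<sqsubseteq> y" "\<not> e l \<sqsubseteq> z" "\<not> e i \<sqsubseteq> z"
      using i that by (simp_all add: J_def)
    then have "e l = e i" by (intro JI_below_not_below_unique[OF z(2)] e_JI)
    then show ?thesis using labelling li by (auto simp: bij_betw_def dest: inj_onD)
  qed
  moreover have "J z \<subseteq> J y" "J x \<subseteq> J z" using z' z xy by (auto simp: J_subset_iff)
  ultimately have "J y - {i} = J z" "i \<in> B - A" using i xy by blast+
  then show "\<exists>i \<in> B - A. B - {i} \<in> closed_sets n cl"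
    unfolding closed_sets_cl using xy z' by (intro bexI[of _ i]) auto
next
  fix A assume A: "A \<subseteq> {1..n}"
  show "cl A \<subseteq> {1..n}" unfolding cl_eq by (rule J_range)
  show "A \<subseteq> cl A" unfolding cl_eq using sup_e(2)[OF A sup_e(1)[OF A]] sup_e(1)[OF A] by simp
  show "cl (cl A) = cl A" unfolding cl_eq using sup_e(1)[OF A] by (simp add: sup_J)
next
  \<comment> \<open>Join-irreducibles differ from \<open>\<bottom>\<close>, so the closure of the
    empty set contains no label.\<close>
  have "\<not> e i \<sqsubseteq> \<bottom>" if "i \<in> {1..n}" for i
    using e_JI[OF that] bottom_least le_antisym[of "e i" \<bottom>] by (auto simp: join_irreducibles_def)
  then have "J \<bottom> = {}" by (auto simp: J_def)
  moreover have "\<Squnion> (e ` {}) = \<bottom>"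
    using sup_e(1)[of "{}"] sup_e(2)[of "{}" \<bottom>] bottom_least by (intro le_antisym) auto
  ultimately show "cl {} = {}" by (simp add: cl_eq)
qed

text \<open>Dualizing \<open>K\<close> matches the reverse inclusion in
  \<open>closed_poset\<close>.\<close>

lemma poset_iso_J:
  "poset_iso (inv_gorder K) (closed_poset n cl) J"
proof (rule poset_isoI)
  show "partial_order (inv_gorder K)" by (rule dual_order)
  show "carrier (closed_poset n cl) = J ` carrier (inv_gorder K)" by (simp add: closed_sets_cl)
  show "eq (closed_poset n cl) = (=)" by (simp add: closed_poset_def)
qed (simp add: J_subset_iff)

end

theorem theorem4p2:
  fixes L :: "'a gorder" and n :: nat and e :: "nat \<Rightarrow> 'a" and \<theta> :: "series \<Rightarrow> series"
  assumes "join_distributive L"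
    and "card (carrier L) > 1"
    and "bij_betw e {1..n} (join_irreducibles (inv_gorder L))"
    and "is_theta \<theta>"
  shows "(\<lambda>m. 2 * F (Q_poset n (lattice_closure (inv_gorder L) n e)) m) = \<theta> (F (adjoin_bottom L))"
proof -
  let ?K = "inv_gorder L"
  have md: "lattice ?K" "finite (carrier ?K)"
    "\<And>y. \<lbrakk>y \<in> carrier ?K; y \<noteq> \<bottom>\<^bsub>?K\<^esub>\<rbrakk> \<Longrightarrow>
      boolean_algebra (interval ?K (\<Sqinter>\<^bsub>?K\<^esub> {x. covered_by ?K x y}) y)"
    using assms(1) unfolding join_distributive_def meet_distributive_def by blast+
  interpret lattice ?K by fact
  interpret K: labelled_meet_distributive_lattice ?K n e
    by unfold_locales (use md assms(2,3) in auto)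
  interpret C: convex_closure n "lattice_closure ?K n e" by (rule K.convex_closure_cl)
  have L: "inv_gorder ?K = L" by simp
  interpret iso: poset_iso L "closed_poset n (lattice_closure ?K n e)" K.J
    using K.poset_iso_J unfolding L .
  interpret iso': poset_iso "adjoin_bottom L" "adjoin_bottom (closed_poset n (lattice_closure ?K n e))"
    "map_option K.J" by (rule iso.poset_iso_adjoin_bottom)
  \<comment> \<open>The isomorphism is applied from the closed sets towards \<open>L\<close>,
    because the grading is known on that side.\<close>
  have "F (adjoin_bottom L) = F (adjoin_bottom (closed_poset n (lattice_closure ?K n e)))"
    using poset_iso.F_image[OF iso'.poset_iso_inv C.graded_M(1)] by simp
  then show ?thesis using C.theta_F_closed[OF assms(4)] by auto
qed

end
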